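(* There exist noncompact locally compact groups $G$ such that $WS(G)=AP(G)$ but $G$ is not minimally weakly almost periodic.
   Context: For a locally compact group $G$, $C(G)$ is the $C^*$-algebra of bounded continuous complex-valued functions on $G$ with the sup norm and $C_0(G)$ is the subalgebra of functions vanishing at infinity. For $f\in C(G)$ and $x,y\in G$ put ${}_xf(z)=f(xz)$ and ${}_xf_y(z)=f(xzy)$; $O_L(f)=\{{}_xf:x\in G\}$ is the left orbit and $O(f)=\{{}_xf_y:x,y\in G\}$ the double orbit. $AP(G)$ (resp. $WAP(G)$) is the set of $f\in C(G)$ such that $O_L(f)$ is relatively norm compact (resp. relatively weakly compact) in $C(G)$. $WS(G)$ is the set of $f\in C(G)$ such that $O(f)$ is relatively weakly compact in $C(G)$. A noncompact locally compact group $G$ is minimally weakly almost periodic if $WAP(G)=AP(G)\oplus C_0(G)$. *)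

theory Defs
  imports "HOL-Analysis.Analysis" "HOL-Algebra.Group"
begin

section \<open>Locally compact groups\<close>

definition topological_group :: "('a, 'b) monoid_scheme \<Rightarrow> 'a topology \<Rightarrow> bool" where
  "topological_group G T \<longleftrightarrow>
     group G \<and> topspace T = carrier G \<and>
     continuous_map (prod_topology T T) T (\<lambda>(x, y). x \<otimes>\<^bsub>G\<^esub> y) \<and>
     continuous_map T T (\<lambda>x. inv\<^bsub>G\<^esub> x)"

definition locally_compact_group :: "('a, 'b) monoid_scheme \<Rightarrow> 'a topology \<Rightarrow> bool" where
  "locally_compact_group G T \<longleftrightarrow>
     topological_group G T \<and> Hausdorff_space T \<and> locally_compact_space T"


section \<open>The Banach space of bounded continuous functions and its weak topology\<close>

text \<open>
  Functions on the space carried by \<open>T\<close> are extensional: they take the value \<open>undefined\<close>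
  outside \<open>topspace T\<close>, so that equality of functions is equality on the space.
  The distance of \<open>Cb_metric T\<close> is the sup distance.
\<close>

abbreviation Cb_metric :: "'a topology \<Rightarrow> ('a \<Rightarrow> complex) metric" where
  "Cb_metric T \<equiv> cfunspace T euclidean_metric"

definition Cb :: "'a topology \<Rightarrow> ('a \<Rightarrow> complex) set" where
  "Cb T = mspace (Cb_metric T)"

definition norm_topology :: "'a topology \<Rightarrow> ('a \<Rightarrow> complex) topology" where
  "norm_topology T = mtopology_of (Cb_metric T)"

definition fun_add :: "'a topology \<Rightarrow> ('a \<Rightarrow> complex) \<Rightarrow> ('a \<Rightarrow> complex) \<Rightarrow> 'a \<Rightarrow> complex" where
  "fun_add T f g = (\<lambda>x\<in>topspace T. f x + g x)"

definition fun_scale :: "'a topology \<Rightarrow> complex \<Rightarrow> ('a \<Rightarrow> complex) \<Rightarrow> 'a \<Rightarrow> complex" where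
  "fun_scale T c f = (\<lambda>x\<in>topspace T. c * f x)"

text \<open>
  The values of a functional outside \<open>Cb T\<close> are unconstrained; they play no role in
  the weak topology.
\<close>

definition Cb_dual :: "'a topology \<Rightarrow> (('a \<Rightarrow> complex) \<Rightarrow> complex) set" where
  "Cb_dual T = {\<phi>.
     (\<forall>f\<in>Cb T. \<forall>g\<in>Cb T. \<phi> (fun_add T f g) = \<phi> f + \<phi> g) \<and>
     (\<forall>c. \<forall>f\<in>Cb T. \<phi> (fun_scale T c f) = c * \<phi> f) \<and>
     continuous_map (norm_topology T) euclidean \<phi>}"

definition weak_topology :: "'a topology \<Rightarrow> ('a \<Rightarrow> complex) topology" where
  "weak_topology T =
     topology_generated_by {{f \<in> Cb T. \<phi> f \<in> U} | \<phi> U. \<phi> \<in> Cb_dual T \<and> open U}"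

definition relatively_compact_in :: "'a topology \<Rightarrow> 'a set \<Rightarrow> bool" where
  "relatively_compact_in X S \<longleftrightarrow> S \<subseteq> topspace X \<and> compactin X (X closure_of S)"

definition C0 :: "'a topology \<Rightarrow> ('a \<Rightarrow> complex) set" where
  "C0 T = {f \<in> Cb T. \<forall>\<epsilon>>0. \<exists>K. compactin T K \<and> (\<forall>x \<in> topspace T - K. norm (f x) < \<epsilon>)}"


section \<open>Orbits and almost periodicity\<close>

definition left_translate :: "('a, 'b) monoid_scheme \<Rightarrow> 'a \<Rightarrow> ('a \<Rightarrow> complex) \<Rightarrow> 'a \<Rightarrow> complex" where
  "left_translate G x f = (\<lambda>z\<in>carrier G. f (x \<otimes>\<^bsub>G\<^esub> z))"

definition two_sided_translate ::
    "('a, 'b) monoid_scheme \<Rightarrow> 'a \<Rightarrow> 'a \<Rightarrow> ('a \<Rightarrow> complex) \<Rightarrow> 'a \<Rightarrow> complex" where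
  "two_sided_translate G x y f = (\<lambda>z\<in>carrier G. f (x \<otimes>\<^bsub>G\<^esub> z \<otimes>\<^bsub>G\<^esub> y))"

definition left_orbit :: "('a, 'b) monoid_scheme \<Rightarrow> ('a \<Rightarrow> complex) \<Rightarrow> ('a \<Rightarrow> complex) set" where
  "left_orbit G f = {left_translate G x f | x. x \<in> carrier G}"

definition double_orbit :: "('a, 'b) monoid_scheme \<Rightarrow> ('a \<Rightarrow> complex) \<Rightarrow> ('a \<Rightarrow> complex) set" where
  "double_orbit G f = {two_sided_translate G x y f | x y. x \<in> carrier G \<and> y \<in> carrier G}"

definition AP :: "('a, 'b) monoid_scheme \<Rightarrow> 'a topology \<Rightarrow> ('a \<Rightarrow> complex) set" where
  "AP G T = {f \<in> Cb T. relatively_compact_in (norm_topology T) (left_orbit G f)}"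

definition WAP :: "('a, 'b) monoid_scheme \<Rightarrow> 'a topology \<Rightarrow> ('a \<Rightarrow> complex) set" where
  "WAP G T = {f \<in> Cb T. relatively_compact_in (weak_topology T) (left_orbit G f)}"

definition WS :: "('a, 'b) monoid_scheme \<Rightarrow> 'a topology \<Rightarrow> ('a \<Rightarrow> complex) set" where
  "WS G T = {f \<in> Cb T. relatively_compact_in (weak_topology T) (double_orbit G f)}"

definition is_direct_sum ::
    "'a topology \<Rightarrow> ('a \<Rightarrow> complex) set \<Rightarrow> ('a \<Rightarrow> complex) set \<Rightarrow> ('a \<Rightarrow> complex) set \<Rightarrow> bool" where
  "is_direct_sum T W A B \<longleftrightarrow>
     W = {fun_add T f g | f g. f \<in> A \<and> g \<in> B} \<and> A \<inter> B = {\<lambda>x\<in>topspace T. 0}"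

text \<open>
  For noncompact groups only; noncompactness is not part of the predicate, so that its negation
  for a noncompact group really denies the decomposition.
\<close>

definition minimally_weakly_almost_periodic ::
    "('a, 'b) monoid_scheme \<Rightarrow> 'a topology \<Rightarrow> bool" where
  "minimally_weakly_almost_periodic G T \<longleftrightarrow> is_direct_sum T (WAP G T) (AP G T) (C0 T)"

text \<open>
  An existential statement over groups has to fix a type for their elements. The type \<open>real\<close>
  serves only as a set of continuum many labels: up to isomorphism, every locally compact group
  with at most continuum many elements has its carrier in it, with a group operation and a
  topology unrelated to those of the real line.
\<close>

type_synonym label = real

end

theory Submission
  imports Defs
begin

text \<open>
  The example is a group \<open>G\<close> of permutations of \<open>nat \<times> bool\<close>, thought of as infinitely many
  two-element blocks. For a set of blocks, given by \<open>\<epsilon> :: nat \<Rightarrow> bool\<close>, let \<open>flip \<epsilon>\<close> exchange the two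
  points of each of these blocks. The flips form a compact group, a product of countably many
  two-element groups, and \<open>G\<close> consists of the permutations that agree with some flip outside a finite
  set. Every element of \<open>G\<close> commutes with all flips of sufficiently late blocks, so the flips, with
  their product topology, are a compact open subgroup for a group topology on \<open>G\<close>.

  Every \<open>f\<close> in \<open>WS G\<close> is constant. A pointwise cluster point of a sequence of two-sided translates of
  \<open>f\<close> that lies in the weak closure of the double orbit is again a continuous function on \<open>G\<close>.
  Therefore (\<open>WS_double_limit\<close>), if \<open>k n\<close> converges to \<open>k'\<close> in \<open>G\<close>, then \<open>f\<close> takes the same value at
  \<open>p = lim\<^sub>m x m \<otimes> k n \<otimes> y m\<close>, supposed independent of \<open>n\<close>, as at \<open>q = lim\<^sub>m x m \<otimes> k' \<otimes> y m\<close>. For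
  \<open>k'\<close> take the flip of an infinite sparse set of blocks, for \<open>k n\<close> its finite truncations, and
  conjugate by finitary permutations of the blocks which bring one member of the set to block 0 and
  move everything else away. The truncations disappear to infinity, whereas \<open>k'\<close> always leaves
  behind the flip of block 0. Hence \<open>f\<close> does not see this flip, which is a transposition; by
  conjugation it sees no transposition at all, and the finitary permutations are dense in \<open>G\<close>
  (\<open>WS_constant\<close>). Almost periodic functions belong to \<open>WS G\<close> for every \<open>G\<close> (\<open>AP_subset_WS\<close>) and
  constants are almost periodic, so both spaces consist of the constants.

  On the other hand, a group having an open, noncompact subgroup \<open>H\<close> of infinite index is never
  minimally weakly almost periodic (\<open>not_minimally_WAP_if_open_subgroup\<close>). The translates of the
  indicator of \<open>H\<close> have pairwise disjoint supports, and such a family converges weakly to 0; so the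
  indicator is weakly almost periodic. It is not the sum of an almost periodic function \<open>a\<close> and a
  function vanishing at infinity, because two of its translates under different cosets would then
  be close to each other far out in a translate of \<open>H\<close>. In \<open>G\<close> one may take for \<open>H\<close> the stabilizer
  of a point.

  The construction is carried out on the image of \<open>G\<close> under an injection into the type of labels.
\<close>

section \<open>The norm and the weak topology\<close>

lemma Cb_iff:
  "f \<in> Cb T \<longleftrightarrow> f \<in> extensional (topspace T) \<and> continuous_map T euclidean f \<and>
     (\<exists>B. \<forall>x\<in>topspace T. norm (f x) \<le> B)"
  unfolding Cb_def by (auto simp: mbounded_iff_bounded bounded_iff)

lemma topspace_norm_topology [simp]: "topspace (norm_topology T) = Cb T"
  by (simp add: norm_topology_def Cb_def)

lemma Cb_dist_le_iff:
  assumes "f \<in> Cb T" "g \<in> Cb T" "topspace T \<noteq> {}"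
  shows "mdist (Cb_metric T) f g \<le> a \<longleftrightarrow> (\<forall>x\<in>topspace T. norm (f x - g x) \<le> a)"
  using assms cfunspace_mdist_le[of f T euclidean_metric g a] unfolding Cb_def by (simp add: dist_norm)

lemma evaluation_in_Cb_dual:
  assumes z: "z \<in> topspace T"
  shows "(\<lambda>f. f z) \<in> Cb_dual T"
proof -
  have "continuous_map (norm_topology T) (mtopology_of euclidean_metric) (\<lambda>f. f z :: complex)"
    unfolding norm_topology_def
  proof (rule Lipschitz_continuous_imp_continuous_map)
    show "Lipschitz_continuous_map (Cb_metric T) euclidean_metric (\<lambda>f. f z :: complex)"
      unfolding Lipschitz_continuous_map_def
      using z cfunspace_mdist_le[of _ T euclidean_metric] 
      by (intro conjI exI[of _ 1]) (fastforce simp del: mspace_cfunspace)+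
  qed
  then show ?thesis
    using z by (auto simp: Cb_dual_def fun_add_def fun_scale_def)
qed

lemma topspace_weak_topology [simp]: "topspace (weak_topology T) = Cb T"
proof -
  have "(\<lambda>f. 0) \<in> Cb_dual T" by (auto simp: Cb_dual_def)
  then show ?thesis
    unfolding weak_topology_def topology_generated_by_topspace
    by (auto intro!: exI[of _ UNIV] exI[of _ "\<lambda>f. 0"] bexI)
qed

lemma openin_weak_basic:
  assumes "\<phi> \<in> Cb_dual T" "open U"
  shows "openin (weak_topology T) {f \<in> Cb T. \<phi> f \<in> U}"
  unfolding weak_topology_def
  by (rule topology_generated_by_Basis) (use assms in blast)

text \<open>
  Point evaluations are continuous functionals and already separate functions.
\<close>

lemma Hausdorff_weak_topology: "Hausdorff_space (weak_topology T)"
  unfolding Hausdorff_space_def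
proof (intro allI impI, elim conjE)
  fix f g assume fg: "f \<in> topspace (weak_topology T)" "g \<in> topspace (weak_topology T)" "f \<noteq> g"
  then obtain z where z: "z \<in> topspace T" "f z \<noteq> g z"
    unfolding topspace_weak_topology Cb_iff by (metis extensionalityI)
  obtain U V where UV: "open U" "open V" "f z \<in> U" "g z \<in> V" "U \<inter> V = {}"
    using z(2) by (meson separation_t2)
  show "\<exists>U V. openin (weak_topology T) U \<and> openin (weak_topology T) V \<and> f \<in> U \<and> g \<in> V \<and> disjnt U V"
    using openin_weak_basic[OF evaluation_in_Cb_dual[OF z(1)]] UV fg
    by (intro exI[of _ "{f \<in> Cb T. f z \<in> U}"] exI[of _ "{f \<in> Cb T. f z \<in> V}"]) (auto simp: disjnt_def)
qed

lemma continuous_map_norm_weak: "continuous_map (norm_topology T) (weak_topology T) (\<lambda>f. f)"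
  unfolding weak_topology_def
proof (rule continuous_on_generated_topo)
  fix W assume "W \<in> {{f \<in> Cb T. \<phi> f \<in> U} |\<phi> U. \<phi> \<in> Cb_dual T \<and> open U}"
  then obtain \<phi> U where \<phi>: "\<phi> \<in> Cb_dual T" "open U" and W: "W = {f \<in> Cb T. \<phi> f \<in> U}" by auto
  have "continuous_map (norm_topology T) euclidean \<phi>" using \<phi> by (simp add: Cb_dual_def)
  then have "openin (norm_topology T) {f \<in> Cb T. \<phi> f \<in> U}"
    using \<phi>(2) by (simp add: continuous_map_def)
  moreover have "(\<lambda>f. f) -` W \<inter> topspace (norm_topology T) = {f \<in> Cb T. \<phi> f \<in> U}"
    using W by auto
  ultimately show "openin (norm_topology T) ((\<lambda>f. f) -` W \<inter> topspace (norm_topology T))" by simp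
next
  show "(\<lambda>f. f) ` topspace (norm_topology T) \<subseteq> \<Union> {{f \<in> Cb T. \<phi> f \<in> U} |\<phi> U. \<phi> \<in> Cb_dual T \<and> open U}"
    using topspace_weak_topology[of T] unfolding weak_topology_def topology_generated_by_topspace by simp
qed

text \<open>
  Relative compactness refers to the closure; in a Hausdorff space it suffices to exhibit some
  compact set containing \<open>S\<close>, as that set is closed.
\<close>

lemma relatively_compact_in_subset_compact:
  assumes "Hausdorff_space X" "compactin X C" "S \<subseteq> C"
  shows "relatively_compact_in X S"
  unfolding relatively_compact_in_def
proof
  show "S \<subseteq> topspace X" using assms compactin_subset_topspace by blast
  have "closedin X C" by (rule compactin_imp_closedin[OF assms(1,2)])
  then have "X closure_of S \<subseteq> C" using assms(3) by (rule closure_of_minimal[rotated])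
  then show "compactin X (X closure_of S)" by (rule closed_compactin[OF assms(2)]) simp
qed

lemma relatively_norm_compact_imp_weak:
  assumes "relatively_compact_in (norm_topology T) S"
  shows "relatively_compact_in (weak_topology T) S"
proof (rule relatively_compact_in_subset_compact[OF Hausdorff_weak_topology])
  show "compactin (weak_topology T) (norm_topology T closure_of S)"
    using image_compactin[OF _ continuous_map_norm_weak] assms
    unfolding relatively_compact_in_def by fastforce
  show "S \<subseteq> norm_topology T closure_of S"
    using assms closure_of_subset unfolding relatively_compact_in_def by blast
qed

text \<open>
  The metric of \<open>Cb T\<close> is complete, so relative compactness is total boundedness, which is here
  expressed by uniform nets.
\<close>

lemma relatively_norm_compact_iff:
  assumes "topspace T \<noteq> {}"
  shows "relatively_compact_in (norm_topology T) S \<longleftrightarrow>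
    S \<subseteq> Cb T \<and> (\<forall>\<epsilon>>0. \<exists>F. finite F \<and> F \<subseteq> S \<and> (\<forall>f\<in>S. \<exists>g\<in>F. \<forall>x\<in>topspace T. norm (f x - g x) \<le> \<epsilon>))"
  (is "_ \<longleftrightarrow> _ \<and> ?R")
proof -
  interpret M: Metric_space "Cb T" "mdist (Cb_metric T)"
    unfolding Cb_def by (rule Metric_space_mspace_mdist)
  have top: "norm_topology T = M.mtopology"
    by (simp add: norm_topology_def mtopology_of_def Cb_def)
  have "mcomplete_of (cfunspace T (metric (UNIV, dist) :: complex metric))"
    using Metric_space.mcomplete_cfunspace[OF Met_TC.Metric_space_axioms, where X = T] complete_UNIV
    unfolding Met_TC.Self_def by simp
  then have "M.mcomplete"
    unfolding mcomplete_of_def Cb_def euclidean_metric_def .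
  then have "relatively_compact_in (norm_topology T) S \<longleftrightarrow> M.mtotally_bounded S"
    unfolding relatively_compact_in_def top by (simp add: M.mtotally_bounded_eq_compact_closure_of)
  also have "\<dots> \<longleftrightarrow> S \<subseteq> Cb T \<and> ?R"
  proof
    assume tb: "M.mtotally_bounded S"
    then have S: "S \<subseteq> Cb T" by (rule M.mtotally_bounded_imp_subset)
    have ?R
    proof (intro allI impI)
      fix \<epsilon> :: real assume e: "\<epsilon> > 0"
      obtain F where F: "finite F" "F \<subseteq> S" "S \<subseteq> (\<Union>x\<in>F. M.mball x \<epsilon>)"
        using tb[unfolded M.mtotally_bounded_def, rule_format, OF e] by metis
      have "\<exists>g\<in>F. \<forall>x\<in>topspace T. norm (f x - g x) \<le> \<epsilon>" if f: "f \<in> S" for f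
      proof -
        obtain g where "g \<in> F" "f \<in> M.mball g \<epsilon>" using F f by blast
        then show ?thesis using Cb_dist_le_iff[of g T f \<epsilon>] assms
          by (intro bexI[of _ g]) (auto simp: norm_minus_commute)
      qed
      then show "\<exists>F. finite F \<and> F \<subseteq> S \<and> (\<forall>f\<in>S. \<exists>g\<in>F. \<forall>x\<in>topspace T. norm (f x - g x) \<le> \<epsilon>)"
        using F by blast
    qed
    with S show "S \<subseteq> Cb T \<and> ?R" by blast
  next
    assume R: "S \<subseteq> Cb T \<and> ?R"
    show "M.mtotally_bounded S"
      unfolding M.mtotally_bounded_def
    proof (intro allI impI)
      fix \<epsilon> :: real assume e: "\<epsilon> > 0"
      then obtain F where F: "finite F" "F \<subseteq> S"
          "\<And>f. f \<in> S \<Longrightarrow> \<exists>g\<in>F. \<forall>x\<in>topspace T. norm (f x - g x) \<le> \<epsilon>/2"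
        using R[THEN conjunct2, rule_format, of "\<epsilon>/2"] by auto
      have "S \<subseteq> (\<Union>x\<in>F. M.mball x \<epsilon>)"
      proof
        fix f assume f: "f \<in> S"
        then obtain g where g: "g \<in> F" "\<forall>x\<in>topspace T. norm (f x - g x) \<le> \<epsilon>/2" using F(3) by blast
        have "g \<in> Cb T" "f \<in> Cb T" using R F(2) g(1) f by auto
        then have "f \<in> M.mball g \<epsilon>"
          using g Cb_dist_le_iff[of g T f "\<epsilon>/2"] assms e by (auto simp: norm_minus_commute)
        then show "f \<in> (\<Union>x\<in>F. M.mball x \<epsilon>)" using g by blast
      qed
      then show "\<exists>K. finite K \<and> K \<subseteq> S \<and> S \<subseteq> (\<Union>x\<in>K. M.mball x \<epsilon>)" using F by blast
    qed
  qed
  finally show ?thesis .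
qed

section \<open>Translations and double limits\<close>

lemma continuous_map_translation:
  assumes G: "topological_group G T" and x: "x \<in> carrier G" and y: "y \<in> carrier G"
  shows "continuous_map T T (\<lambda>z. x \<otimes>\<^bsub>G\<^esub> z \<otimes>\<^bsub>G\<^esub> y)"
proof -
  have top: "topspace T = carrier G"
    and mult: "continuous_map (prod_topology T T) T (\<lambda>(x, y). x \<otimes>\<^bsub>G\<^esub> y)"
    using G by (auto simp: topological_group_def)
  have "continuous_map T (prod_topology T T) (\<lambda>z. (x, z))"
    using x top by (simp add: continuous_map_pairedI)
  from continuous_map_compose[OF this mult] have 1: "continuous_map T T (\<lambda>z. x \<otimes>\<^bsub>G\<^esub> z)"
    by (simp add: o_def)
  have "continuous_map T (prod_topology T T) (\<lambda>z. (x \<otimes>\<^bsub>G\<^esub> z, y))"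
    using 1 y top by (simp add: continuous_map_pairedI)
  from continuous_map_compose[OF this mult] show ?thesis by (simp add: o_def)
qed

lemma limitin_translation:
  assumes "topological_group G T" "x \<in> carrier G" "y \<in> carrier G" "limitin T u l F"
  shows "limitin T (\<lambda>i. x \<otimes>\<^bsub>G\<^esub> u i \<otimes>\<^bsub>G\<^esub> y) (x \<otimes>\<^bsub>G\<^esub> l \<otimes>\<^bsub>G\<^esub> y) F"
  using continuous_map_limit[OF continuous_map_translation[OF assms(1-3)] assms(4)]
  by (simp add: o_def)

lemma two_sided_translate_in_Cb:
  assumes G: "topological_group G T" and x: "x \<in> carrier G" and y: "y \<in> carrier G"
    and f: "f \<in> Cb T"
  shows "two_sided_translate G x y f \<in> Cb T"
proof -
  interpret group G using G by (simp add: topological_group_def)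
  have top: "topspace T = carrier G" using G by (simp add: topological_group_def)
  have "continuous_map T euclidean (f \<circ> (\<lambda>z. x \<otimes>\<^bsub>G\<^esub> z \<otimes>\<^bsub>G\<^esub> y))"
    using f by (intro continuous_map_compose[OF continuous_map_translation[OF G x y]]) (simp add: Cb_iff)
  then have "continuous_map T euclidean (two_sided_translate G x y f)"
    by (rule continuous_map_eq) (simp add: two_sided_translate_def top)
  then show ?thesis
    using f x y unfolding Cb_iff by (auto simp: two_sided_translate_def top)
qed

lemma left_translate_eq_two_sided:
  assumes "group G" "x \<in> carrier G"
  shows "left_translate G x f = two_sided_translate G x \<one>\<^bsub>G\<^esub> f"
proof -
  interpret group G by fact
  show ?thesis unfolding left_translate_def two_sided_translate_def
    by (rule restrict_ext) (use assms in simp)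
qed

text \<open>
  The cluster point is taken in the weak topology, where the closure of the double orbit is
  compact; weak cluster points are pointwise cluster points, because evaluations are functionals.
  What matters is that it lies in \<open>Cb T\<close>, that is, that it is continuous.
\<close>

lemma translates_have_pointwise_cluster_point:
  assumes G: "topological_group G T" and f: "f \<in> WS G T"
    and x: "\<And>m::nat. x m \<in> carrier G" and y: "\<And>m. y m \<in> carrier G"
  obtains h where "h \<in> Cb T"
    "\<And>z c. \<lbrakk>z \<in> carrier G; (\<lambda>m. f (x m \<otimes>\<^bsub>G\<^esub> z \<otimes>\<^bsub>G\<^esub> y m)) \<longlonglongrightarrow> c\<rbrakk> \<Longrightarrow> h z = c"
proof -
  have top: "topspace T = carrier G" using G by (simp add: topological_group_def)
  define X where "X = weak_topology T"
  define C where "C = X closure_of double_orbit G f"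
  define F where "F m = two_sided_translate G (x m) (y m) f" for m
  define D where "D m = X closure_of (F ` {m..})" for m
  have f: "f \<in> Cb T" and C: "compactin X C"
    using f by (auto simp: WS_def relatively_compact_in_def X_def C_def)
  have F: "F m \<in> Cb T" for m unfolding F_def by (rule two_sided_translate_in_Cb[OF G x y f])
  have orb: "F m \<in> double_orbit G f" for m using x y by (auto simp: F_def double_orbit_def)
  have D_C: "D m \<subseteq> C" for m
    unfolding C_def D_def by (rule closure_of_mono) (use orb in auto)
  have inD: "F n \<in> D m" if "m \<le> n" for m n
    unfolding D_def by (rule subsetD[OF closure_of_subset]) (use that F in \<open>auto simp: X_def\<close>)
  have "C \<inter> \<Inter>(range D) \<noteq> {}"
  proof (rule compactin_fip[THEN iffD1, OF C, THEN conjunct2, rule_format])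
    show "(\<forall>A\<in>range D. closedin X A) \<and> (\<forall>\<F>. finite \<F> \<and> \<F> \<subseteq> range D \<longrightarrow> C \<inter> \<Inter>\<F> \<noteq> {})"
    proof (intro conjI allI impI)
      show "\<forall>A\<in>range D. closedin X A" by (auto simp: D_def)
      fix \<F> assume "finite \<F> \<and> \<F> \<subseteq> range D"
      then obtain M where M: "finite M" "\<F> = D ` M" by (metis finite_subset_image)
      then have "F (Max (insert 0 M)) \<in> C \<inter> \<Inter>\<F>"
        using inD D_C[of 0] by (auto intro!: inD)
      then show "C \<inter> \<Inter>\<F> \<noteq> {}" by blast
    qed
  qed
  then obtain h where h: "\<And>m. h \<in> D m" by blast
  have hCb: "h \<in> Cb T" using h[of 0] unfolding D_def by (auto simp: in_closure_of X_def)
  show ?thesis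
  proof
    show "h \<in> Cb T" by (rule hCb)
    fix z c assume z: "z \<in> carrier G" and lim: "(\<lambda>m. f (x m \<otimes>\<^bsub>G\<^esub> z \<otimes>\<^bsub>G\<^esub> y m)) \<longlonglongrightarrow> c"
    show "h z = c"
    proof (rule ccontr)
      assume ne: "h z \<noteq> c"
      then obtain U V where UV: "open U" "open V" "h z \<in> U" "c \<in> V" "U \<inter> V = {}"
        by (meson separation_t2)
      obtain m where m: "\<And>n. n \<ge> m \<Longrightarrow> f (x n \<otimes>\<^bsub>G\<^esub> z \<otimes>\<^bsub>G\<^esub> y n) \<in> V"
        using topological_tendstoD[OF lim UV(2,4)] by (auto simp: eventually_sequentially)
      have "openin X {g \<in> Cb T. g z \<in> U}"
        unfolding X_def using z top by (intro openin_weak_basic evaluation_in_Cb_dual UV) auto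
      moreover have "h \<in> {g \<in> Cb T. g z \<in> U}" using hCb UV(3) by simp
      ultimately obtain g where "g \<in> F ` {m..}" "g z \<in> U"
        using h[of m] unfolding D_def in_closure_of by (metis (no_types, lifting) mem_Collect_eq)
      then obtain n where "n \<ge> m" "F n z \<in> U" by auto
      then show False using m[of n] UV(5) z by (auto simp: F_def two_sided_translate_def)
    qed
  qed
qed

text \<open>
  This is the easy half of Grothendieck's double limit criterion, for point evaluations along a
  sequence that converges inside the group: a cluster point \<open>h\<close> of the translates has the value
  \<open>f p\<close> at each \<open>k n\<close> and \<open>f q\<close> at \<open>k'\<close>, and \<open>h\<close> is continuous.
\<close>

lemma WS_double_limit:
  assumes G: "topological_group G T" and f: "f \<in> WS G T"
    and x: "\<And>m::nat. x m \<in> carrier G" and y: "\<And>m. y m \<in> carrier G"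
    and k: "\<And>n::nat. k n \<in> carrier G" and klim: "limitin T k k' sequentially"
    and p: "\<And>n. limitin T (\<lambda>m. x m \<otimes>\<^bsub>G\<^esub> k n \<otimes>\<^bsub>G\<^esub> y m) p sequentially"
    and q: "limitin T (\<lambda>m. x m \<otimes>\<^bsub>G\<^esub> k' \<otimes>\<^bsub>G\<^esub> y m) q sequentially"
  shows "f p = f q"
proof -
  have top: "topspace T = carrier G" using G by (simp add: topological_group_def)
  have fcont: "continuous_map T euclidean f" using f by (simp add: WS_def Cb_iff)
  obtain h where h: "h \<in> Cb T"
    and hlim: "\<And>z c. \<lbrakk>z \<in> carrier G; (\<lambda>m. f (x m \<otimes>\<^bsub>G\<^esub> z \<otimes>\<^bsub>G\<^esub> y m)) \<longlonglongrightarrow> c\<rbrakk> \<Longrightarrow> h z = c"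
    using translates_have_pointwise_cluster_point[where x = x and y = y, OF G f x y] by blast
  have k': "k' \<in> carrier G" using limitin_topspace[OF klim] top by simp
  have hk: "h (k n) = f p" for n
    using hlim[OF k] continuous_map_limit[OF fcont p] by (simp add: o_def)
  have hk': "h k' = f q"
    using hlim[OF k'] continuous_map_limit[OF fcont q] by (simp add: o_def)
  have "continuous_map T euclidean h" using h by (simp add: Cb_iff)
  from continuous_map_limit[OF this klim] have "(\<lambda>n. h (k n)) \<longlonglongrightarrow> h k'" by (simp add: o_def)
  then show ?thesis using hk hk' by (simp add: LIMSEQ_const_iff)
qed

section \<open>Almost periodic functions\<close>

text \<open>
  Rounding each of the finitely many bounded coordinates to a finite net leaves finitely many
  patterns; one representative of each pattern forms the net.
\<close>

lemma finitely_many_value_patterns: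
  fixes v :: "'i \<Rightarrow> 'a \<Rightarrow> complex"
  assumes "finite X" and B: "\<And>i a. i \<in> X \<Longrightarrow> a \<in> A \<Longrightarrow> norm (v i a) \<le> B" and e: "\<epsilon> > 0"
  shows "\<exists>Y. finite Y \<and> Y \<subseteq> A \<and> (\<forall>a\<in>A. \<exists>b\<in>Y. \<forall>i\<in>X. norm (v i a - v i b) \<le> \<epsilon>)"
proof -
  obtain Z where Z: "finite Z" "cball (0::complex) B \<subseteq> (\<Union>x\<in>Z. ball x (\<epsilon>/2))"
    using compact_eq_totally_bounded[of "cball (0::complex) B"] e compact_cball half_gt_zero by metis
  then have "\<forall>w\<in>cball 0 B. \<exists>c\<in>Z. dist c w < \<epsilon>/2" by fastforce
  then obtain c where c: "\<And>w. norm w \<le> B \<Longrightarrow> c w \<in> Z \<and> dist (c w) w < \<epsilon>/2"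
    by (metis mem_cball_0)
  define \<phi> where "\<phi> a = (\<lambda>i\<in>X. c (v i a))" for a
  have "\<phi> ` A \<subseteq> X \<rightarrow>\<^sub>E Z" using c B by (auto simp: \<phi>_def)
  then have fin: "finite (\<phi> ` A)" using finite_PiE[OF assms(1)] Z(1) by (metis finite_subset)
  define Y where "Y = inv_into A \<phi> ` \<phi> ` A"
  have "\<exists>b\<in>Y. \<forall>i\<in>X. norm (v i a - v i b) \<le> \<epsilon>" if a: "a \<in> A" for a
  proof
    let ?b = "inv_into A \<phi> (\<phi> a)"
    show "?b \<in> Y" using a by (auto simp: Y_def)
    have bA: "?b \<in> A" and eq: "\<phi> ?b = \<phi> a"
      using a by (auto intro: inv_into_into f_inv_into_f)
    show "\<forall>i\<in>X. norm (v i a - v i ?b) \<le> \<epsilon>"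
    proof
      fix i assume i: "i \<in> X"
      have "c (v i ?b) = c (v i a)" using fun_cong[OF eq, of i] i by (simp add: \<phi>_def)
      moreover have "dist (c (v i a)) (v i a) < \<epsilon>/2" "dist (c (v i ?b)) (v i ?b) < \<epsilon>/2"
        using c B i a bA by auto
      ultimately have "dist (v i a) (v i ?b) < \<epsilon>/2 + \<epsilon>/2"
        by (metis dist_triangle_half_r field_sum_of_halves)
      then show "norm (v i a - v i ?b) \<le> \<epsilon>" by (simp add: dist_norm)
    qed
  qed
  moreover have "Y \<subseteq> A" unfolding Y_def by (auto intro: inv_into_into)
  ultimately show ?thesis using fin unfolding Y_def by blast
qed

lemma left_orbit_finite_net:
  assumes G: "topological_group G T" and f: "relatively_compact_in (norm_topology T) (left_orbit G f)"
    and e: "\<epsilon> > 0"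
  obtains X where "finite X" "X \<subseteq> carrier G"
    "\<And>x. x \<in> carrier G \<Longrightarrow> \<exists>x'\<in>X. \<forall>z\<in>carrier G. norm (f (x \<otimes>\<^bsub>G\<^esub> z) - f (x' \<otimes>\<^bsub>G\<^esub> z)) \<le> \<epsilon>"
proof -
  interpret group G using G by (simp add: topological_group_def)
  have top: "topspace T = carrier G" using G by (simp add: topological_group_def)
  have ne: "topspace T \<noteq> {}" using top by auto
  obtain F where F: "finite F" "F \<subseteq> left_orbit G f"
      "\<forall>g\<in>left_orbit G f. \<exists>g'\<in>F. \<forall>x\<in>topspace T. norm (g x - g' x) \<le> \<epsilon>"
    using f[unfolded relatively_norm_compact_iff[OF ne], THEN conjunct2, rule_format, OF e] by metis
  have "left_orbit G f = (\<lambda>x. left_translate G x f) ` carrier G" by (auto simp: left_orbit_def)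
  then obtain X where X: "finite X" "X \<subseteq> carrier G" "F = (\<lambda>x. left_translate G x f) ` X"
    using F(1,2) by (metis finite_subset_image)
  show ?thesis
  proof (rule that[OF X(1,2)])
    fix x assume "x \<in> carrier G"
    then have "left_translate G x f \<in> left_orbit G f" by (auto simp: left_orbit_def)
    then obtain x' where "x' \<in> X"
        "\<forall>z\<in>carrier G. norm (left_translate G x f z - left_translate G x' f z) \<le> \<epsilon>"
      using F(3) X(3) top by auto
    then show "\<exists>x'\<in>X. \<forall>z\<in>carrier G. norm (f (x \<otimes>\<^bsub>G\<^esub> z) - f (x' \<otimes>\<^bsub>G\<^esub> z)) \<le> \<epsilon>"
      by (auto simp: left_translate_def)
  qed
qed

text \<open>
  A finite net \<open>X\<close> for the left translates also controls right translates: up to a small error,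
  \<open>f (x \<otimes> y)\<close> depends on the values \<open>f (x' \<otimes> y)\<close> with \<open>x'\<close> in \<open>X\<close> only. Thus the double orbit is
  totally bounded as well, and norm compactness implies weak compactness.
\<close>

lemma AP_subset_WS:
  assumes G: "topological_group G T"
  shows "AP G T \<subseteq> WS G T"
proof
  interpret group G using G by (simp add: topological_group_def)
  have top: "topspace T = carrier G" using G by (simp add: topological_group_def)
  have ne: "topspace T \<noteq> {}" using top by auto
  fix f assume "f \<in> AP G T"
  then have f: "f \<in> Cb T" and ap: "relatively_compact_in (norm_topology T) (left_orbit G f)"
    by (auto simp: AP_def)
  obtain B where B: "\<And>z. z \<in> carrier G \<Longrightarrow> norm (f z) \<le> B" using f top by (auto simp: Cb_iff)
  have "relatively_compact_in (norm_topology T) (double_orbit G f)"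
    unfolding relatively_norm_compact_iff[OF ne]
  proof (intro conjI allI impI)
    show "double_orbit G f \<subseteq> Cb T"
      using two_sided_translate_in_Cb[OF G _ _ f] by (auto simp: double_orbit_def)
    fix \<epsilon> :: real assume e: "\<epsilon> > 0"
    obtain X where X: "finite X" "X \<subseteq> carrier G" and net:
      "\<And>x. x \<in> carrier G \<Longrightarrow> \<exists>x'\<in>X. \<forall>z\<in>carrier G. norm (f (x \<otimes>\<^bsub>G\<^esub> z) - f (x' \<otimes>\<^bsub>G\<^esub> z)) \<le> \<epsilon>/4"
      using left_orbit_finite_net[OF G ap, of "\<epsilon>/4"] e by auto
    have "\<exists>Y. finite Y \<and> Y \<subseteq> carrier G \<and> (\<forall>y\<in>carrier G. \<exists>y'\<in>Y. \<forall>x\<in>X.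
        norm (f (x \<otimes>\<^bsub>G\<^esub> y) - f (x \<otimes>\<^bsub>G\<^esub> y')) \<le> \<epsilon>/4)"
      using finitely_many_value_patterns[of X "carrier G" "\<lambda>x y. f (x \<otimes>\<^bsub>G\<^esub> y)" B "\<epsilon>/4"] X B e
      by (auto simp: subset_iff)
    then obtain Y where Y: "finite Y" "Y \<subseteq> carrier G" and netY: "\<And>y. y \<in> carrier G \<Longrightarrow>
        \<exists>y'\<in>Y. \<forall>x\<in>X. norm (f (x \<otimes>\<^bsub>G\<^esub> y) - f (x \<otimes>\<^bsub>G\<^esub> y')) \<le> \<epsilon>/4" by blast
    let ?F = "(\<lambda>(x, y). two_sided_translate G x y f) ` (X \<times> Y)"
    have "\<exists>g\<in>?F. \<forall>z\<in>topspace T. norm (u z - g z) \<le> \<epsilon>" if u_orbit: "u \<in> double_orbit G f" for u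
    proof -
      obtain x y where xy: "x \<in> carrier G" "y \<in> carrier G" and u: "u = two_sided_translate G x y f"
        using u_orbit unfolding double_orbit_def by blast
      obtain x' where x': "x' \<in> X" "\<forall>z\<in>carrier G. norm (f (x \<otimes>\<^bsub>G\<^esub> z) - f (x' \<otimes>\<^bsub>G\<^esub> z)) \<le> \<epsilon>/4"
        using net[OF xy(1)] by blast
      obtain y' where y': "y' \<in> Y" "\<forall>x\<in>X. norm (f (x \<otimes>\<^bsub>G\<^esub> y) - f (x \<otimes>\<^bsub>G\<^esub> y')) \<le> \<epsilon>/4"
        using netY[OF xy(2)] by blast
      have c: "x' \<in> carrier G" "y' \<in> carrier G" using x' y' X Y by auto
      have "norm (f (x \<otimes>\<^bsub>G\<^esub> z \<otimes>\<^bsub>G\<^esub> y) - f (x' \<otimes>\<^bsub>G\<^esub> z \<otimes>\<^bsub>G\<^esub> y')) \<le> \<epsilon>" if z: "z \<in> carrier G" for z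
      proof -
        obtain x'' where x'': "x'' \<in> X"
            "\<forall>w\<in>carrier G. norm (f (x' \<otimes>\<^bsub>G\<^esub> z \<otimes>\<^bsub>G\<^esub> w) - f (x'' \<otimes>\<^bsub>G\<^esub> w)) \<le> \<epsilon>/4"
          using net[of "x' \<otimes>\<^bsub>G\<^esub> z"] c z by auto
        have 1: "norm (f (x \<otimes>\<^bsub>G\<^esub> z \<otimes>\<^bsub>G\<^esub> y) - f (x' \<otimes>\<^bsub>G\<^esub> z \<otimes>\<^bsub>G\<^esub> y)) \<le> \<epsilon>/4"
          using x'(2)[rule_format, of "z \<otimes>\<^bsub>G\<^esub> y"] xy z c by (simp add: m_assoc)
        have 2: "norm (f (x' \<otimes>\<^bsub>G\<^esub> z \<otimes>\<^bsub>G\<^esub> y) - f (x'' \<otimes>\<^bsub>G\<^esub> y)) \<le> \<epsilon>/4"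
          using x''(2) xy(2) by blast
        have 3: "norm (f (x'' \<otimes>\<^bsub>G\<^esub> y) - f (x'' \<otimes>\<^bsub>G\<^esub> y')) \<le> \<epsilon>/4"
          using y'(2) x''(1) by blast
        have 4: "norm (f (x'' \<otimes>\<^bsub>G\<^esub> y') - f (x' \<otimes>\<^bsub>G\<^esub> z \<otimes>\<^bsub>G\<^esub> y')) \<le> \<epsilon>/4"
          using x''(2)[rule_format, OF c(2)] by (simp add: norm_minus_commute)
        have "norm (f (x \<otimes>\<^bsub>G\<^esub> z \<otimes>\<^bsub>G\<^esub> y) - f (x' \<otimes>\<^bsub>G\<^esub> z \<otimes>\<^bsub>G\<^esub> y')) \<le> \<epsilon>/4 + (\<epsilon>/4 + (\<epsilon>/4 + \<epsilon>/4))"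
          by (rule norm_diff_triangle_le[OF 1 norm_diff_triangle_le[OF 2 norm_diff_triangle_le[OF 3 4]]])
        then show ?thesis by simp
      qed
      then have "\<forall>z\<in>topspace T. norm (u z - two_sided_translate G x' y' f z) \<le> \<epsilon>"
        by (simp add: u top two_sided_translate_def)
      moreover have "two_sided_translate G x' y' f \<in> ?F" using x'(1) y'(1) by force
      ultimately show ?thesis by blast
    qed
    moreover have "finite ?F" "?F \<subseteq> double_orbit G f" using X Y by (auto simp: double_orbit_def)
    ultimately show "\<exists>F. finite F \<and> F \<subseteq> double_orbit G f \<and>
        (\<forall>u\<in>double_orbit G f. \<exists>g\<in>F. \<forall>z\<in>topspace T. norm (u z - g z) \<le> \<epsilon>)" by blast
  qed
  then show "f \<in> WS G T" using f relatively_norm_compact_imp_weak by (auto simp: WS_def)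
qed

lemma const_in_AP:
  assumes G: "topological_group G T"
  shows "(\<lambda>x\<in>carrier G. c) \<in> AP G T"
proof -
  interpret group G using G by (simp add: topological_group_def)
  have top: "topspace T = carrier G" using G by (simp add: topological_group_def)
  have ne: "topspace T \<noteq> {}" using top by auto
  let ?f = "\<lambda>x\<in>carrier G. c"
  have "continuous_map T euclidean ?f"
    by (rule continuous_map_eq[of _ _ "\<lambda>_. c"]) (auto simp: top)
  moreover have "\<forall>x\<in>topspace T. norm (?f x) \<le> norm c" by (simp add: top)
  ultimately have f: "?f \<in> Cb T" unfolding Cb_iff top by blast
  have const: "left_translate G x ?f = ?f" if "x \<in> carrier G" for x
    unfolding left_translate_def by (rule restrict_ext) (use that in simp)
  have "left_orbit G ?f = (\<lambda>x. left_translate G x ?f) ` carrier G"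
    unfolding left_orbit_def by (rule Setcompr_eq_image)
  also have "\<dots> = (\<lambda>x. ?f) ` carrier G" by (rule image_cong[OF refl const])
  also have "\<dots> = {?f}" by (rule image_constant[OF one_closed])
  finally have orb: "left_orbit G ?f = {?f}" .
  have "relatively_compact_in (norm_topology T) {?f}"
    unfolding relatively_norm_compact_iff[OF ne]
  proof (intro conjI allI impI)
    show "{?f} \<subseteq> Cb T" using f by simp
    fix \<epsilon> :: real assume "\<epsilon> > 0"
    then show "\<exists>F. finite F \<and> F \<subseteq> {?f} \<and> (\<forall>u\<in>{?f}. \<exists>g\<in>F. \<forall>z\<in>topspace T. norm (u z - g z) \<le> \<epsilon>)"
      by (intro exI[of _ "{?f}"]) simp
  qed
  then show ?thesis using f by (simp only: AP_def orb mem_Collect_eq simp_thms)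
qed

section \<open>Families of functions with disjoint supports\<close>

lemma zero_in_Cb: "(\<lambda>x\<in>topspace T. 0) \<in> Cb T"
proof -
  have "continuous_map T euclidean (\<lambda>x\<in>topspace T. 0 :: complex)"
    by (rule continuous_map_eq[of _ _ "\<lambda>_. 0"]) auto
  moreover have "\<forall>x\<in>topspace T. norm ((\<lambda>x\<in>topspace T. 0 :: complex) x) \<le> 0" by simp
  ultimately show ?thesis unfolding Cb_iff by blast
qed

lemma Cb_dual_zero:
  assumes "\<phi> \<in> Cb_dual T"
  shows "\<phi> (\<lambda>x\<in>topspace T. 0) = 0"
proof -
  have "\<phi> (fun_scale T 0 (\<lambda>x\<in>topspace T. 0)) = 0 * \<phi> (\<lambda>x\<in>topspace T. 0)"
    using assms zero_in_Cb unfolding Cb_dual_def by blast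
  moreover have "fun_scale T 0 (\<lambda>x\<in>topspace T. 0) = (\<lambda>x\<in>topspace T. 0)"
    unfolding fun_scale_def by (rule restrict_ext) simp
  ultimately show ?thesis by simp
qed

lemma Cb_dual_bounded:
  assumes \<phi>: "\<phi> \<in> Cb_dual T" and ne: "topspace T \<noteq> {}"
  obtains \<delta> where "\<delta> > 0"
    "\<And>g. \<lbrakk>g \<in> Cb T; \<And>z. z \<in> topspace T \<Longrightarrow> norm (g z) \<le> \<delta>\<rbrakk> \<Longrightarrow> norm (\<phi> g) < 1"
proof -
  interpret M: Metric_space "Cb T" "mdist (Cb_metric T)"
    unfolding Cb_def by (rule Metric_space_mspace_mdist)
  have top: "norm_topology T = M.mtopology"
    by (simp add: norm_topology_def mtopology_of_def Cb_def)
  let ?null = "\<lambda>x\<in>topspace T. 0 :: complex"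
  have "continuous_map (norm_topology T) euclidean \<phi>" using \<phi> by (simp add: Cb_dual_def)
  then have "openin M.mtopology {f \<in> Cb T. \<phi> f \<in> ball 0 1}"
    unfolding continuous_map_def top[symmetric] topspace_norm_topology
    by (metis open_ball open_openin)
  moreover have "?null \<in> {f \<in> Cb T. \<phi> f \<in> ball 0 1}"
    using Cb_dual_zero[OF \<phi>] zero_in_Cb by simp
  ultimately obtain r where r: "r > 0" "M.mball ?null r \<subseteq> {f \<in> Cb T. \<phi> f \<in> ball 0 1}"
    unfolding M.openin_mtopology by blast
  show ?thesis
  proof
    show "r/2 > 0" using r by simp
    fix g assume g: "g \<in> Cb T" "\<And>z. z \<in> topspace T \<Longrightarrow> norm (g z) \<le> r/2"
    have "mdist (Cb_metric T) ?null g \<le> r/2"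
      using g(2) by (subst Cb_dist_le_iff[OF zero_in_Cb g(1) ne]) simp
    then have "g \<in> M.mball ?null r" using r(1) g(1) zero_in_Cb[of T] by simp
    then show "norm (\<phi> g) < 1" using r(2) by auto
  qed
qed

lemma Cb_linear_combination:
  assumes \<phi>: "\<phi> \<in> Cb_dual T" and "finite A" "A \<subseteq> Cb T"
  shows "(\<lambda>z\<in>topspace T. \<Sum>h\<in>A. c h * h z) \<in> Cb T \<and>
         \<phi> (\<lambda>z\<in>topspace T. \<Sum>h\<in>A. c h * h z) = (\<Sum>h\<in>A. c h * \<phi> h)"
  using assms(2,3)
proof (induction A)
  case empty
  then show ?case unfolding sum.empty using zero_in_Cb Cb_dual_zero[OF \<phi>] by blast
next
  case (insert u A)
  let ?g = "\<lambda>z\<in>topspace T. \<Sum>h\<in>A. c h * h z"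
  let ?g' = "\<lambda>z\<in>topspace T. \<Sum>h\<in>insert u A. c h * h z"
  have IH: "?g \<in> Cb T" "\<phi> ?g = (\<Sum>h\<in>A. c h * \<phi> h)" and u: "u \<in> Cb T"
    using insert.IH insert.prems by blast+
  have scale: "fun_scale T (c u) u \<in> Cb T"
  proof -
    obtain B where "\<forall>x\<in>topspace T. norm (u x) \<le> B" using u unfolding Cb_iff by blast
    then have "\<forall>x\<in>topspace T. norm (fun_scale T (c u) u x) \<le> norm (c u) * B"
      by (simp add: fun_scale_def norm_mult mult_left_mono)
    moreover have "continuous_map T euclidean (fun_scale T (c u) u)"
    proof (rule continuous_map_eq)
      have "continuous_map euclidean euclidean (\<lambda>w. c u * w)"
        by (intro continuous_map_iff_continuous2[THEN iffD2] continuous_intros)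
      then show "continuous_map T euclidean ((\<lambda>w. c u * w) \<circ> u)"
        using u by (intro continuous_map_compose) (auto simp: Cb_iff)
    qed (simp add: fun_scale_def)
    ultimately show ?thesis unfolding Cb_iff by (auto simp: fun_scale_def)
  qed
  have eq: "?g' = fun_add T (fun_scale T (c u) u) ?g"
    unfolding fun_add_def by (rule restrict_ext) (use insert in \<open>simp add: fun_scale_def\<close>)
  have "?g' \<in> Cb T"
  proof -
    obtain B where B: "\<forall>x\<in>topspace T. norm (?g x) \<le> B" using IH(1) unfolding Cb_iff by blast
    obtain B' where B': "\<forall>x\<in>topspace T. norm (fun_scale T (c u) u x) \<le> B'" using scale unfolding Cb_iff by blast
    have "\<forall>x\<in>topspace T. norm (?g' x) \<le> B' + B"
      unfolding eq using B B' by (auto simp: fun_add_def intro!: norm_triangle_mono)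
    moreover have "continuous_map T euclidean ?g'"
    proof -
      have "continuous_map T euclidean ?g" "continuous_map T euclidean (fun_scale T (c u) u)"
        using IH(1) scale unfolding Cb_iff by blast+
      from continuous_map_add[OF this(2,1)] show ?thesis
        unfolding eq by (rule continuous_map_eq) (simp add: fun_add_def)
    qed
    ultimately show ?thesis unfolding Cb_iff by auto
  qed
  moreover have "\<phi> ?g' = c u * \<phi> u + \<phi> ?g"
    unfolding eq using \<phi> scale IH(1) u by (simp add: Cb_dual_def)
  moreover have "(\<Sum>h\<in>insert u A. c h * \<phi> h) = c u * \<phi> u + (\<Sum>h\<in>A. c h * \<phi> h)"
    using insert.hyps by simp
  ultimately show ?case unfolding IH(2) by presburger
qed

text \<open>
  Functions with disjoint supports behave like the unit vectors of \<open>c\<^sub>0\<close>: a combination with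
  coefficients of modulus \<open>\<delta>\<close> still has sup norm at most \<open>\<delta>\<close>, no matter how many functions enter.
  Choosing the phases so that all terms \<open>\<phi> h\<close> add up bounds the number of large terms.
\<close>

lemma functional_small_on_disjoint_family:
  assumes \<phi>: "\<phi> \<in> Cb_dual T" and ne: "topspace T \<noteq> {}" and S: "\<S> \<subseteq> Cb T"
    and le1: "\<And>h z. \<lbrakk>h \<in> \<S>; z \<in> topspace T\<rbrakk> \<Longrightarrow> norm (h z) \<le> 1"
    and disj: "\<And>h h' z. \<lbrakk>h \<in> \<S>; h' \<in> \<S>; z \<in> topspace T; h z \<noteq> 0; h' z \<noteq> 0\<rbrakk> \<Longrightarrow> h = h'"
    and e: "\<epsilon> > 0"
  shows "finite {h \<in> \<S>. \<epsilon> \<le> norm (\<phi> h)}"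
proof (rule ccontr)
  assume inf: "infinite {h \<in> \<S>. \<epsilon> \<le> norm (\<phi> h)}"
  obtain \<delta> where \<delta>: "\<delta> > 0"
    "\<And>g. \<lbrakk>g \<in> Cb T; \<And>z. z \<in> topspace T \<Longrightarrow> norm (g z) \<le> \<delta>\<rbrakk> \<Longrightarrow> norm (\<phi> g) < 1"
    using Cb_dual_bounded[OF \<phi> ne] by blast
  obtain n :: nat where n: "1 / (\<delta> * \<epsilon>) < real n" using reals_Archimedean2 by blast
  obtain A where A: "A \<subseteq> {h \<in> \<S>. \<epsilon> \<le> norm (\<phi> h)}" "finite A" "card A = n"
    using infinite_arbitrarily_large[OF inf] by metis
  \<comment> \<open>the phase of \<open>c h\<close> makes \<open>c h * \<phi> h\<close> a positive real\<close>
  define c where "c h = \<delta> * cnj (\<phi> h) / norm (\<phi> h)" for h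
  let ?g = "\<lambda>z\<in>topspace T. \<Sum>h\<in>A. c h * h z"
  have ASub: "A \<subseteq> Cb T" "A \<subseteq> \<S>" using A S by auto
  have g: "?g \<in> Cb T" "\<phi> ?g = (\<Sum>h\<in>A. c h * \<phi> h)"
    using Cb_linear_combination[OF \<phi> A(2) ASub(1), of c] by auto
  have normc: "norm (c h) = \<delta>" if "h \<in> A" for h
  proof -
    have "\<phi> h \<noteq> 0" using A(1) that e by force
    then show ?thesis using \<delta>(1) by (simp add: c_def norm_mult norm_divide)
  qed
  have "norm (\<phi> ?g) < 1"
  proof (rule \<delta>(2)[OF g(1)])
    fix z assume z: "z \<in> topspace T"
    show "norm (?g z) \<le> \<delta>"
    proof (cases "\<exists>h\<in>A. h z \<noteq> 0")
      case True
      then obtain h where h: "h \<in> A" "h z \<noteq> 0" by blast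
      have 0: "c h' * h' z = 0" if "h' \<in> A - {h}" for h'
      proof -
        have "h' z = 0" using disj[of h h' z] that h ASub(2) z by blast
        then show ?thesis by simp
      qed
      have "(\<Sum>h\<in>A. c h * h z) = c h * h z + (\<Sum>h\<in>A-{h}. c h * h z)"
        using A(2) h(1) by (rule sum.remove)
      also have "(\<Sum>h\<in>A-{h}. c h * h z) = 0" by (rule sum.neutral) (use 0 in blast)
      finally have "norm (?g z) = \<delta> * norm (h z)" using z normc[OF h(1)] by (simp add: norm_mult)
      also have "\<dots> \<le> \<delta>" using le1[of h z] h(1) ASub(2) z \<delta>(1) by (simp add: subset_iff mult_left_le)
      finally show ?thesis .
    next
      case False
      then have "(\<Sum>h\<in>A. c h * h z) = 0" by (intro sum.neutral) auto
      then show ?thesis using z \<delta>(1) by simp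
    qed
  qed
  moreover have "\<phi> ?g = of_real (\<Sum>h\<in>A. \<delta> * norm (\<phi> h))"
  proof -
    have "c h * \<phi> h = of_real (\<delta> * norm (\<phi> h))" if "h \<in> A" for h
    proof -
      have "\<phi> h \<noteq> 0" using A(1) that e by force
      have "c h * \<phi> h = of_real \<delta> * (\<phi> h * cnj (\<phi> h)) / of_real (norm (\<phi> h))"
        by (simp add: c_def)
      also have "\<dots> = of_real \<delta> * of_real (norm (\<phi> h) ^ 2) / of_real (norm (\<phi> h))"
        by (simp only: complex_norm_square)
      finally show ?thesis using \<open>\<phi> h \<noteq> 0\<close> by (simp add: power2_eq_square)
    qed
    then show ?thesis unfolding g(2) of_real_sum by (rule sum.cong[OF refl])
  qed
  moreover have "(\<Sum>h\<in>A. \<delta> * \<epsilon>) \<le> (\<Sum>h\<in>A. \<delta> * norm (\<phi> h))"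
    by (rule sum_mono) (use A(1) \<delta>(1) in \<open>auto intro!: mult_left_mono\<close>)
  then have "real n * (\<delta> * \<epsilon>) \<le> (\<Sum>h\<in>A. \<delta> * norm (\<phi> h))" using A(3) by simp
  ultimately have "real n * (\<delta> * \<epsilon>) < 1" by (metis abs_ge_self dual_order.strict_trans1 norm_of_real order.strict_trans1)
  then show False using n \<delta>(1) e by (simp add: field_simps)
qed

text \<open>
  Every weak neighbourhood of 0 contains all but finitely many members of the family. So the
  family together with 0 is compact.
\<close>

lemma disjoint_family_relatively_weakly_compact:
  assumes ne: "topspace T \<noteq> {}" and S: "\<S> \<subseteq> Cb T"
    and le1: "\<And>h z. \<lbrakk>h \<in> \<S>; z \<in> topspace T\<rbrakk> \<Longrightarrow> norm (h z) \<le> 1"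
    and disj: "\<And>h h' z. \<lbrakk>h \<in> \<S>; h' \<in> \<S>; z \<in> topspace T; h z \<noteq> 0; h' z \<noteq> 0\<rbrakk> \<Longrightarrow> h = h'"
  shows "relatively_compact_in (weak_topology T) \<S>"
proof (rule relatively_compact_in_subset_compact[OF Hausdorff_weak_topology])
  let ?null = "\<lambda>x\<in>topspace T. 0 :: complex"
  show "\<S> \<subseteq> insert ?null \<S>" by blast
  have fin: "finite (\<S> - W)"
    if "generate_topology_on {{f \<in> Cb T. \<phi> f \<in> U} | \<phi> U. \<phi> \<in> Cb_dual T \<and> open U} W" "?null \<in> W" for W
    using that
  proof (induction rule: generate_topology_on.induct)
    case Empty
    then show ?case by simp
  next
    case (Int a b)
    then show ?case by (simp add: Diff_Int)
  next
    case (UN K)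
    then obtain k where "k \<in> K" "finite (\<S> - k)" by blast
    then show ?case by (metis Diff_mono Union_upper finite_subset order_refl)
  next
    case (Basis W)
    then obtain \<phi> U where \<phi>: "\<phi> \<in> Cb_dual T" "open U" and W: "W = {f \<in> Cb T. \<phi> f \<in> U}" by blast
    have "\<phi> ?null \<in> U" using Basis(2) unfolding W mem_Collect_eq by (rule conjunct2)
    then have "0 \<in> U" unfolding Cb_dual_zero[OF \<phi>(1)] .
    then obtain \<epsilon> where e: "\<epsilon> > 0" "ball 0 \<epsilon> \<subseteq> U" using \<phi>(2) openE by blast
    have "\<S> - W \<subseteq> {h \<in> \<S>. \<epsilon> \<le> norm (\<phi> h)}"
    proof
      fix h assume h: "h \<in> \<S> - W"
      then have "\<phi> h \<notin> ball 0 \<epsilon>" using W S e(2) by blast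
      then show "h \<in> {h \<in> \<S>. \<epsilon> \<le> norm (\<phi> h)}" using h by simp
    qed
    moreover have "finite {h \<in> \<S>. \<epsilon> \<le> norm (\<phi> h)}"
      by (rule functional_small_on_disjoint_family[OF \<phi>(1) ne S _ _ e(1)]) (fact le1 disj)+
    ultimately show ?case by (rule finite_subset)
  qed
  show "compactin (weak_topology T) (insert ?null \<S>)"
    unfolding compactin_def
  proof (intro conjI allI impI)
    show "insert ?null \<S> \<subseteq> topspace (weak_topology T)" using S zero_in_Cb by simp
    fix \<U> assume U: "(\<forall>U\<in>\<U>. openin (weak_topology T) U) \<and> insert ?null \<S> \<subseteq> \<Union>\<U>"
    then obtain W where W: "W \<in> \<U>" "?null \<in> W" by blast
    have "finite (\<S> - W)"
      using U W fin unfolding weak_topology_def openin_topology_generated_by_iff by blast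
    moreover have "\<S> - W \<subseteq> \<Union>\<U>" using U by blast
    ultimately obtain \<F> where "finite \<F>" "\<F> \<subseteq> \<U>" "\<S> - W \<subseteq> \<Union>\<F>"
      by (rule finite_subset_Union)
    then show "\<exists>\<F>. finite \<F> \<and> \<F> \<subseteq> \<U> \<and> insert ?null \<S> \<subseteq> \<Union>\<F>"
      using W by (intro exI[of _ "insert W \<F>"]) auto
  qed
qed

section \<open>Open subgroups and weakly almost periodic indicators\<close>

definition subgroup_indicator :: "('a, 'b) monoid_scheme \<Rightarrow> 'a set \<Rightarrow> 'a \<Rightarrow> complex" where
  "subgroup_indicator G H = (\<lambda>z\<in>carrier G. if z \<in> H then 1 else 0)"

text \<open>
  The complement is a union of cosets.
\<close>

lemma open_subgroup_closed:
  assumes G: "topological_group G T" and H: "subgroup H G" "openin T H"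
  shows "closedin T H"
proof -
  interpret group G using G by (simp add: topological_group_def)
  interpret H: subgroup H G by fact
  have top: "topspace T = carrier G" using G by (simp add: topological_group_def)
  have "\<exists>U. openin T U \<and> z \<in> U \<and> U \<subseteq> carrier G - H" if z: "z \<in> carrier G - H" for z
  proof (intro exI conjI)
    let ?U = "{w \<in> topspace T. inv\<^bsub>G\<^esub> z \<otimes>\<^bsub>G\<^esub> w \<otimes>\<^bsub>G\<^esub> \<one>\<^bsub>G\<^esub> \<in> H}"
    show "openin T ?U"
      using continuous_map_translation[OF G, of "inv\<^bsub>G\<^esub> z" "\<one>\<^bsub>G\<^esub>"] z H(2)
      unfolding continuous_map_def by simp
    show "z \<in> ?U" using z top by simp
    show "?U \<subseteq> carrier G - H"
    proof
      fix w assume w: "w \<in> ?U"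
      then have 1: "w \<in> carrier G" "inv\<^bsub>G\<^esub> z \<otimes>\<^bsub>G\<^esub> w \<in> H" using top z by auto
      have "w \<notin> H"
      proof
        assume "w \<in> H"
        then have "w \<otimes>\<^bsub>G\<^esub> inv\<^bsub>G\<^esub> (inv\<^bsub>G\<^esub> z \<otimes>\<^bsub>G\<^esub> w) \<in> H" using 1 by simp
        also have "w \<otimes>\<^bsub>G\<^esub> inv\<^bsub>G\<^esub> (inv\<^bsub>G\<^esub> z \<otimes>\<^bsub>G\<^esub> w) = z"
          using 1 z by (simp add: inv_mult_group m_assoc[symmetric])
        finally show False using z by simp
      qed
      then show "w \<in> carrier G - H" using 1 by simp
    qed
  qed
  then have "openin T (carrier G - H)" by (subst openin_subopen) blast
  then show ?thesis using top H.subset by (simp add: closedin_def)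
qed

text \<open>
  The left translates of the indicator of \<open>H\<close> are the indicators of the left cosets of \<open>H\<close>, which
  are pairwise disjoint or equal.
\<close>

lemma subgroup_indicator_in_WAP:
  assumes G: "topological_group G T" and H: "subgroup H G" "openin T H"
  shows "subgroup_indicator G H \<in> WAP G T"
proof -
  interpret group G using G by (simp add: topological_group_def)
  interpret H: subgroup H G by fact
  have top: "topspace T = carrier G" using G by (simp add: topological_group_def)
  have ne: "topspace T \<noteq> {}" using top by auto
  let ?f = "subgroup_indicator G H"
  have oc: "openin T (carrier G - H)"
    using open_subgroup_closed[OF G H] top by (simp add: closedin_def)
  have "openin T {z \<in> topspace T. ?f z \<in> U}" for U
  proof -
    have "{z \<in> topspace T. ?f z \<in> U} =
        (if 1 \<in> U then H else {}) \<union> (if 0 \<in> U then carrier G - H else {})"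
      using H.subset by (auto simp: subgroup_indicator_def top)
    then show ?thesis using H(2) oc by (auto simp del: Un_Diff_cancel intro: openin_Un)
  qed
  then have "continuous_map T euclidean ?f" by (simp add: continuous_map_def)
  moreover have "\<forall>z\<in>topspace T. norm (?f z) \<le> 1" by (simp add: subgroup_indicator_def top)
  ultimately have f: "?f \<in> Cb T" unfolding Cb_iff by (auto simp: subgroup_indicator_def top)
  have "relatively_compact_in (weak_topology T) (left_orbit G ?f)"
  proof (rule disjoint_family_relatively_weakly_compact[OF ne])
    show "left_orbit G ?f \<subseteq> Cb T"
      using two_sided_translate_in_Cb[OF G _ one_closed f]
      by (auto simp: left_orbit_def left_translate_eq_two_sided)
    show "norm (h z) \<le> 1" if "h \<in> left_orbit G ?f" "z \<in> topspace T" for h z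
      using that by (auto simp: left_orbit_def left_translate_def subgroup_indicator_def top)
    fix h h' z assume hh: "h \<in> left_orbit G ?f" "h' \<in> left_orbit G ?f" "z \<in> topspace T" "h z \<noteq> 0" "h' z \<noteq> 0"
    then obtain x x' where x: "x \<in> carrier G" "x' \<in> carrier G"
      "h = left_translate G x ?f" "h' = left_translate G x' ?f"
      unfolding left_orbit_def by blast
    have z: "z \<in> carrier G" "x \<otimes>\<^bsub>G\<^esub> z \<in> H" "x' \<otimes>\<^bsub>G\<^esub> z \<in> H"
      using hh(3-5) x by (auto simp: left_translate_def subgroup_indicator_def top split: if_splits)
    have q: "x \<otimes>\<^bsub>G\<^esub> inv\<^bsub>G\<^esub> x' \<in> H"
    proof -
      have "(x \<otimes>\<^bsub>G\<^esub> z) \<otimes>\<^bsub>G\<^esub> inv\<^bsub>G\<^esub> (x' \<otimes>\<^bsub>G\<^esub> z) \<in> H" using z by simp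
      also have "(x \<otimes>\<^bsub>G\<^esub> z) \<otimes>\<^bsub>G\<^esub> inv\<^bsub>G\<^esub> (x' \<otimes>\<^bsub>G\<^esub> z) = x \<otimes>\<^bsub>G\<^esub> inv\<^bsub>G\<^esub> x'"
        using x z by (simp add: inv_mult_group m_assoc) (simp add: m_assoc[symmetric])
      finally show ?thesis .
    qed
    have "x \<otimes>\<^bsub>G\<^esub> w \<in> H \<longleftrightarrow> x' \<otimes>\<^bsub>G\<^esub> w \<in> H" if w: "w \<in> carrier G" for w
    proof -
      have eq: "x \<otimes>\<^bsub>G\<^esub> w = (x \<otimes>\<^bsub>G\<^esub> inv\<^bsub>G\<^esub> x') \<otimes>\<^bsub>G\<^esub> (x' \<otimes>\<^bsub>G\<^esub> w)"
        using x w by (simp add: m_assoc) (simp add: m_assoc[symmetric])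
      show ?thesis
      proof
        assume "x' \<otimes>\<^bsub>G\<^esub> w \<in> H" then show "x \<otimes>\<^bsub>G\<^esub> w \<in> H" unfolding eq using q by simp
      next
        assume a: "x \<otimes>\<^bsub>G\<^esub> w \<in> H"
        have "x' \<otimes>\<^bsub>G\<^esub> w = inv\<^bsub>G\<^esub> (x \<otimes>\<^bsub>G\<^esub> inv\<^bsub>G\<^esub> x') \<otimes>\<^bsub>G\<^esub> (x \<otimes>\<^bsub>G\<^esub> w)"
          unfolding eq using x w by (simp add: inv_solve_left)
        then show "x' \<otimes>\<^bsub>G\<^esub> w \<in> H" using a q by simp
      qed
    qed
    then show "h = h'" unfolding x(3,4) left_translate_def
      by (intro restrict_ext) (use x in \<open>simp add: subgroup_indicator_def\<close>)
  qed
  then show ?thesis using f by (simp add: WAP_def)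
qed

text \<open>
  The set \<open>X\<close> expresses that \<open>H\<close> has infinite index. By the pigeonhole principle two of the
  translates of \<open>a\<close> by elements \<open>x \<noteq> y\<close> of \<open>X\<close> are uniformly close. As \<open>H\<close> is not covered by two
  compact sets, there is \<open>z\<close> with \<open>x \<otimes> z\<close> in \<open>H\<close>, hence \<open>y \<otimes> z\<close> not in \<open>H\<close>, such that \<open>c\<close> is small
  at both points. There the indicator takes the values 1 and 0, but the sum takes nearby values.
\<close>

lemma subgroup_indicator_not_AP_plus_C0:
  assumes G: "topological_group G T" and H: "subgroup H G" "openin T H" "\<not> compactin T H"
    and X: "infinite X" "X \<subseteq> carrier G"
    and sep: "\<And>x y. \<lbrakk>x \<in> X; y \<in> X; x \<noteq> y\<rbrakk> \<Longrightarrow> x \<otimes>\<^bsub>G\<^esub> inv\<^bsub>G\<^esub> y \<notin> H"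
    and a: "a \<in> AP G T" and c: "c \<in> C0 T"
  shows "subgroup_indicator G H \<noteq> fun_add T a c"
proof
  interpret group G using G by (simp add: topological_group_def)
  interpret H: subgroup H G by fact
  have top: "topspace T = carrier G" using G by (simp add: topological_group_def)
  assume eq: "subgroup_indicator G H = fun_add T a c"
  have ind: "a z + c z = (if z \<in> H then 1 else 0)" if "z \<in> carrier G" for z
    using fun_cong[OF eq, of z] that by (simp add: subgroup_indicator_def fun_add_def top)
  have ap: "relatively_compact_in (norm_topology T) (left_orbit G a)" using a by (simp add: AP_def)
  obtain N where N: "finite N" "N \<subseteq> carrier G" and net:
    "\<And>x. x \<in> carrier G \<Longrightarrow> \<exists>x'\<in>N. \<forall>z\<in>carrier G. norm (a (x \<otimes>\<^bsub>G\<^esub> z) - a (x' \<otimes>\<^bsub>G\<^esub> z)) \<le> 1/8"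
    using left_orbit_finite_net[OF G ap, of "1/8"] by auto
  then obtain \<nu> where \<nu>: "\<And>x. x \<in> carrier G \<Longrightarrow> \<nu> x \<in> N"
    "\<And>x z. \<lbrakk>x \<in> carrier G; z \<in> carrier G\<rbrakk> \<Longrightarrow> norm (a (x \<otimes>\<^bsub>G\<^esub> z) - a (\<nu> x \<otimes>\<^bsub>G\<^esub> z)) \<le> 1/8"
    by metis
  have "\<not> inj_on \<nu> X"
  proof
    assume inj: "inj_on \<nu> X"
    have "\<nu> ` X \<subseteq> N" using X(2) \<nu>(1) by blast
    then have "finite X" by (rule inj_on_finite[OF inj _ N(1)])
    then show False using X(1) by simp
  qed
  then obtain x y where xy: "x \<in> X" "y \<in> X" "x \<noteq> y" "\<nu> x = \<nu> y" unfolding inj_on_def by blast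
  have xyG: "x \<in> carrier G" "y \<in> carrier G" using xy X by auto
  have close: "norm (a (x \<otimes>\<^bsub>G\<^esub> z) - a (y \<otimes>\<^bsub>G\<^esub> z)) \<le> 1/8 + 1/8" if z: "z \<in> carrier G" for z
    by (rule norm_diff_triangle_le[OF \<nu>(2)[OF xyG(1) z]])
      (use \<nu>(2)[OF xyG(2) z] xy(4) in \<open>simp add: norm_minus_commute\<close>)
  have "\<forall>\<epsilon>>0. \<exists>K. compactin T K \<and> (\<forall>z\<in>carrier G - K. norm (c z) < \<epsilon>)"
    using c by (simp add: C0_def top)
  from this[rule_format, of "1/4"] obtain K
    where K: "compactin T K" "\<And>z. z \<in> carrier G - K \<Longrightarrow> norm (c z) < 1/4" by (metis zero_less_divide_1_iff zero_less_numeral)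
  define g where "g = y \<otimes>\<^bsub>G\<^esub> inv\<^bsub>G\<^esub> x"
  have g: "g \<in> carrier G" using xyG by (simp add: g_def)
  define K' where "K' = (\<lambda>z. inv\<^bsub>G\<^esub> g \<otimes>\<^bsub>G\<^esub> z \<otimes>\<^bsub>G\<^esub> \<one>\<^bsub>G\<^esub>) ` K"
  have K': "compactin T K'"
    unfolding K'_def using g by (intro image_compactin[OF K(1)] continuous_map_translation[OF G]) auto
  have KG: "K \<subseteq> carrier G" using K(1) compactin_subset_topspace top by blast
  have "\<not> H \<subseteq> K \<union> K'"
  proof
    assume "H \<subseteq> K \<union> K'"
    then have "compactin T H"
      by (rule closed_compactin[OF compactin_Un[OF K(1) K'] _ open_subgroup_closed[OF G H(1,2)]])
    then show False using H(3) by simp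
  qed
  then obtain h where h: "h \<in> H" "h \<notin> K" "h \<notin> K'" by blast
  have hG: "h \<in> carrier G" using h(1) by simp
  have gh: "g \<otimes>\<^bsub>G\<^esub> h \<notin> K"
  proof
    assume "g \<otimes>\<^bsub>G\<^esub> h \<in> K"
    then have "inv\<^bsub>G\<^esub> g \<otimes>\<^bsub>G\<^esub> (g \<otimes>\<^bsub>G\<^esub> h) \<otimes>\<^bsub>G\<^esub> \<one>\<^bsub>G\<^esub> \<in> K'" unfolding K'_def by blast
    then show False using h(3) g hG by (simp add: m_assoc[symmetric])
  qed
  have ghH: "g \<otimes>\<^bsub>G\<^esub> h \<notin> H"
  proof
    assume "g \<otimes>\<^bsub>G\<^esub> h \<in> H"
    then have "(g \<otimes>\<^bsub>G\<^esub> h) \<otimes>\<^bsub>G\<^esub> inv\<^bsub>G\<^esub> h \<in> H" using h(1) by simp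
    then have "g \<in> H" using g hG by (simp add: m_assoc)
    then show False using sep[OF xy(2,1)] xy(3) by (auto simp: g_def)
  qed
  define z where "z = inv\<^bsub>G\<^esub> x \<otimes>\<^bsub>G\<^esub> h"
  have z: "z \<in> carrier G" "x \<otimes>\<^bsub>G\<^esub> z = h" "y \<otimes>\<^bsub>G\<^esub> z = g \<otimes>\<^bsub>G\<^esub> h"
    using xyG hG by (simp_all add: z_def g_def m_assoc[symmetric])
  have "a h + c h = 1" "a (g \<otimes>\<^bsub>G\<^esub> h) + c (g \<otimes>\<^bsub>G\<^esub> h) = 0"
    using ind[of h] ind[of "g \<otimes>\<^bsub>G\<^esub> h"] h(1) ghH g hG by auto
  then have "1 = (a h - a (g \<otimes>\<^bsub>G\<^esub> h)) + (c h - c (g \<otimes>\<^bsub>G\<^esub> h))"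
    by (simp add: algebra_simps)
  then have "1 = norm ((a h - a (g \<otimes>\<^bsub>G\<^esub> h)) + (c h - c (g \<otimes>\<^bsub>G\<^esub> h)))" by (metis norm_one)
  also have "\<dots> \<le> norm (a h - a (g \<otimes>\<^bsub>G\<^esub> h)) + norm (c h - c (g \<otimes>\<^bsub>G\<^esub> h))" by (rule norm_triangle_ineq)
  also have "\<dots> \<le> (1/8 + 1/8) + (norm (c h) + norm (c (g \<otimes>\<^bsub>G\<^esub> h)))"
    using close[OF z(1)] z(2,3) by (intro add_mono norm_triangle_ineq4) simp
  also have "\<dots> < (1/8 + 1/8) + (1/4 + 1/4)"
    using K(2)[of h] K(2)[of "g \<otimes>\<^bsub>G\<^esub> h"] h(2) gh hG g by simp
  finally show False by simp
qed

lemma not_minimally_WAP_if_open_subgroup: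
  assumes G: "topological_group G T" and H: "subgroup H G" "openin T H" "\<not> compactin T H"
    and X: "infinite X" "X \<subseteq> carrier G"
    and sep: "\<And>x y. \<lbrakk>x \<in> X; y \<in> X; x \<noteq> y\<rbrakk> \<Longrightarrow> x \<otimes>\<^bsub>G\<^esub> inv\<^bsub>G\<^esub> y \<notin> H"
  shows "\<not> minimally_weakly_almost_periodic G T"
  using subgroup_indicator_in_WAP[OF G H(1,2)] subgroup_indicator_not_AP_plus_C0[OF assms]
  unfolding minimally_weakly_almost_periodic_def is_direct_sum_def by blast

section \<open>Topologies from filtrations by subgroups\<close>

text \<open>
  A descending sequence of subgroups is a neighbourhood base of the unit for a group topology as
  soon as conjugation by each element is continuous. Here conjugation by \<open>x\<close> is even trivial on
  some \<open>K n\<close>.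
\<close>

locale filtered_group = group G for G :: "('a, 'b) monoid_scheme" (structure) +
  fixes K :: "nat \<Rightarrow> 'a set"
  assumes K_subgroup: "subgroup (K n) G"
    and K_decreasing: "m \<le> n \<Longrightarrow> K n \<subseteq> K m"
    and K_separating: "\<lbrakk>x \<in> carrier G; \<And>n. x \<in> K n\<rbrakk> \<Longrightarrow> x = \<one>"
    and K_eventually_central: "x \<in> carrier G \<Longrightarrow> \<exists>n. \<forall>\<kappa>\<in>K n. x \<otimes> \<kappa> = \<kappa> \<otimes> x"
begin

definition coset_topology :: "'a topology" where
  "coset_topology = topology (\<lambda>U. U \<subseteq> carrier G \<and> (\<forall>x\<in>U. \<exists>n. \<forall>\<kappa>\<in>K n. x \<otimes> \<kappa> \<in> U))"

lemma K_carrier: "\<kappa> \<in> K n \<Longrightarrow> \<kappa> \<in> carrier G"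
  using subgroup.mem_carrier[OF K_subgroup] .

lemma openin_coset_topology:
  "openin coset_topology U \<longleftrightarrow> U \<subseteq> carrier G \<and> (\<forall>x\<in>U. \<exists>n. \<forall>\<kappa>\<in>K n. x \<otimes> \<kappa> \<in> U)"
proof -
  have "istopology (\<lambda>U. U \<subseteq> carrier G \<and> (\<forall>x\<in>U. \<exists>n. \<forall>\<kappa>\<in>K n. x \<otimes> \<kappa> \<in> U))"
    unfolding istopology_def
  proof (intro conjI allI impI ballI, goal_cases)
    case (2 S U x)
    then obtain m n where m: "\<forall>\<kappa>\<in>K m. x \<otimes> \<kappa> \<in> S" and n: "\<forall>\<kappa>\<in>K n. x \<otimes> \<kappa> \<in> U" by blast
    show ?case
      by (rule exI[of _ "max m n"])
        (use m n K_decreasing[of m "max m n"] K_decreasing[of n "max m n"] in auto)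
  next
    case (4 \<K> x)
    then show ?case by (meson Union_iff)
  qed auto
  then show ?thesis unfolding coset_topology_def by (simp add: topology_inverse')
qed

lemma topspace_coset_topology [simp]: "topspace coset_topology = carrier G"
proof -
  have "openin coset_topology (carrier G)"
    unfolding openin_coset_topology using K_carrier by auto
  then show ?thesis unfolding topspace_def openin_coset_topology by blast
qed

lemma openin_coset:
  assumes x: "x \<in> carrier G"
  shows "openin coset_topology {y \<in> carrier G. inv x \<otimes> y \<in> K n}"
  unfolding openin_coset_topology
proof (intro conjI ballI exI[of _ n])
  fix y \<kappa> assume y: "y \<in> {y \<in> carrier G. inv x \<otimes> y \<in> K n}" and \<kappa>: "\<kappa> \<in> K n"
  have "inv x \<otimes> (y \<otimes> \<kappa>) = inv x \<otimes> y \<otimes> \<kappa>" using x y K_carrier[OF \<kappa>] by (simp add: m_assoc)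
  then show "y \<otimes> \<kappa> \<in> {y \<in> carrier G. inv x \<otimes> y \<in> K n}"
    using y \<kappa> K_carrier[OF \<kappa>] subgroup.m_closed[OF K_subgroup] by auto
qed auto

lemma limitin_coset_topology:
  assumes "l \<in> carrier G" "\<And>n. eventually (\<lambda>i. u i \<in> carrier G \<and> inv l \<otimes> u i \<in> K n) F"
  shows "limitin coset_topology u l F"
  unfolding limitin_def
proof (intro conjI allI impI)
  show "l \<in> topspace coset_topology" using assms(1) by simp
  fix U assume U: "openin coset_topology U \<and> l \<in> U"
  then obtain n where n: "\<forall>\<kappa>\<in>K n. l \<otimes> \<kappa> \<in> U" unfolding openin_coset_topology by blast
  show "eventually (\<lambda>i. u i \<in> U) F"
    using assms(2)[of n]
  proof eventually_elim
    case (elim i)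
    then have "l \<otimes> (inv l \<otimes> u i) \<in> U" using n by blast
    then show ?case using elim assms(1) by (simp add: m_assoc[symmetric])
  qed
qed

lemma topological_group_coset_topology: "topological_group G coset_topology"
  unfolding topological_group_def
proof (intro conjI)
  show "group G" ..
  show "topspace coset_topology = carrier G" by simp
  show "continuous_map (prod_topology coset_topology coset_topology) coset_topology (\<lambda>(x, y). x \<otimes> y)"
    unfolding continuous_map_def
  proof (intro conjI allI impI)
    show "(\<lambda>(x, y). x \<otimes> y) \<in> topspace (prod_topology coset_topology coset_topology) \<rightarrow> topspace coset_topology"
      by auto
    fix U assume U: "openin coset_topology U"
    let ?P = "{p \<in> topspace (prod_topology coset_topology coset_topology). (case p of (x, y) \<Rightarrow> x \<otimes> y) \<in> U}"
    show "openin (prod_topology coset_topology coset_topology) ?P"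
      unfolding openin_prod_topology_alt
    proof (intro allI impI)
      fix x y assume "(x, y) \<in> ?P"
      then have xy: "x \<in> carrier G" "y \<in> carrier G" "x \<otimes> y \<in> U" by auto
      obtain n where n: "\<forall>\<kappa>\<in>K n. (x \<otimes> y) \<otimes> \<kappa> \<in> U" using U xy(3) unfolding openin_coset_topology by blast
      obtain m where m: "\<forall>\<kappa>\<in>K m. y \<otimes> \<kappa> = \<kappa> \<otimes> y" using K_eventually_central[OF xy(2)] by blast
      let ?V = "{x' \<in> carrier G. inv x \<otimes> x' \<in> K (max m n)}" and ?W = "{y' \<in> carrier G. inv y \<otimes> y' \<in> K n}"
      have "x' \<otimes> y' \<in> U" if "x' \<in> ?V" "y' \<in> ?W" for x' y'
      proof -
        define \<kappa> \<mu> where "\<kappa> = inv x \<otimes> x'" and "\<mu> = inv y \<otimes> y'"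
        have \<kappa>: "\<kappa> \<in> K m" "\<kappa> \<in> K n"
          using that(1) K_decreasing[of m "max m n"] K_decreasing[of n "max m n"] by (auto simp: \<kappa>_def)
        have \<mu>: "\<mu> \<in> K n" using that(2) by (simp add: \<mu>_def)
        have c: "\<kappa> \<in> carrier G" "\<mu> \<in> carrier G" using \<kappa> \<mu> K_carrier by auto
        have x': "x' = x \<otimes> \<kappa>" and y': "y' = y \<otimes> \<mu>"
          using that xy by (simp_all add: \<kappa>_def \<mu>_def m_assoc[symmetric])
        \<comment> \<open>moving \<open>\<kappa>\<close> past \<open>y\<close> collects both deviations on the right\<close>
        have "x' \<otimes> y' = x \<otimes> (\<kappa> \<otimes> y) \<otimes> \<mu>" using xy c by (simp add: x' y' m_assoc)
        also have "\<kappa> \<otimes> y = y \<otimes> \<kappa>" using m \<kappa>(1) by simp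
        also have "x \<otimes> (y \<otimes> \<kappa>) \<otimes> \<mu> = (x \<otimes> y) \<otimes> (\<kappa> \<otimes> \<mu>)" using xy c by (simp add: m_assoc)
        finally show ?thesis using n subgroup.m_closed[OF K_subgroup \<kappa>(2) \<mu>] by simp
      qed
      then have "?V \<times> ?W \<subseteq> ?P" by auto
      moreover have "x \<in> ?V" "y \<in> ?W" using xy subgroup.one_closed[OF K_subgroup] by auto
      ultimately show "\<exists>V W. openin coset_topology V \<and> openin coset_topology W \<and> x \<in> V \<and> y \<in> W \<and> V \<times> W \<subseteq> ?P"
        using openin_coset xy(1,2) by blast
    qed
  qed
  show "continuous_map coset_topology coset_topology (\<lambda>x. inv x)"
    unfolding continuous_map_def
  proof (intro conjI allI impI)
    show "(\<lambda>x. inv x) \<in> topspace coset_topology \<rightarrow> topspace coset_topology" by auto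
    fix U assume U: "openin coset_topology U"
    show "openin coset_topology {x \<in> topspace coset_topology. inv x \<in> U}"
      unfolding openin_coset_topology
    proof (intro conjI ballI)
      fix x assume x: "x \<in> {x \<in> topspace coset_topology. inv x \<in> U}"
      then have xG: "x \<in> carrier G" by simp
      obtain n where n: "\<forall>\<kappa>\<in>K n. inv x \<otimes> \<kappa> \<in> U" using U x unfolding openin_coset_topology by blast
      obtain m where m: "\<forall>\<kappa>\<in>K m. x \<otimes> \<kappa> = \<kappa> \<otimes> x" using K_eventually_central[OF xG] by blast
      show "\<exists>n. \<forall>\<kappa>\<in>K n. x \<otimes> \<kappa> \<in> {x \<in> topspace coset_topology. inv x \<in> U}"
      proof (intro exI[of _ "max m n"] ballI)
        fix \<kappa> assume "\<kappa> \<in> K (max m n)"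
        then have \<kappa>: "\<kappa> \<in> K m" "\<kappa> \<in> K n"
          using K_decreasing[of m "max m n"] K_decreasing[of n "max m n"] by auto
        have c: "\<kappa> \<in> carrier G" using \<kappa> K_carrier by auto
        have "inv (x \<otimes> \<kappa>) = inv x \<otimes> inv \<kappa>" using m \<kappa>(1) xG c by (simp add: inv_mult_group)
        also have "\<dots> \<in> U" using n subgroup.m_inv_closed[OF K_subgroup \<kappa>(2)] by simp
        finally show "x \<otimes> \<kappa> \<in> {x \<in> topspace coset_topology. inv x \<in> U}" using xG c by simp
      qed
    qed auto
  qed
qed

lemma Hausdorff_coset_topology: "Hausdorff_space coset_topology"
  unfolding Hausdorff_space_def
proof (intro allI impI, elim conjE)
  fix x y assume "x \<in> topspace coset_topology" "y \<in> topspace coset_topology" and ne: "x \<noteq> y"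
  then have xy: "x \<in> carrier G" "y \<in> carrier G" by auto
  obtain n where n: "inv x \<otimes> y \<notin> K n"
  proof -
    have "inv x \<otimes> y \<noteq> \<one>" using ne xy by (metis inv_equality inv_inv inv_closed)
    then show ?thesis using K_separating[of "inv x \<otimes> y"] xy that by blast
  qed
  let ?V = "\<lambda>x. {z \<in> carrier G. inv x \<otimes> z \<in> K n}"
  have "?V x \<inter> ?V y = {}"
  proof (rule ccontr)
    assume "?V x \<inter> ?V y \<noteq> {}"
    then obtain z where z: "z \<in> carrier G" "inv x \<otimes> z \<in> K n" "inv y \<otimes> z \<in> K n" by blast
    have "(inv x \<otimes> z) \<otimes> inv (inv y \<otimes> z) \<in> K n"
      using z subgroup.m_closed[OF K_subgroup] subgroup.m_inv_closed[OF K_subgroup] by blast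
    also have "(inv x \<otimes> z) \<otimes> inv (inv y \<otimes> z) = inv x \<otimes> y"
      using xy z(1) by (simp add: inv_mult_group m_assoc) (simp add: m_assoc[symmetric])
    finally show False using n by simp
  qed
  moreover have "x \<in> ?V x" "y \<in> ?V y" using xy subgroup.one_closed[OF K_subgroup] by auto
  ultimately show "\<exists>U V. openin coset_topology U \<and> openin coset_topology V \<and> x \<in> U \<and> y \<in> V \<and> disjnt U V"
    using openin_coset xy unfolding disjnt_def by blast
qed

lemma locally_compact_group_coset_topology:
  assumes K0: "compactin coset_topology (K 0)"
  shows "locally_compact_group G coset_topology"
  unfolding locally_compact_group_def
proof (intro conjI topological_group_coset_topology Hausdorff_coset_topology)
  show "locally_compact_space coset_topology"
    unfolding locally_compact_space_def
  proof
    fix x assume "x \<in> topspace coset_topology"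
    then have x: "x \<in> carrier G" by simp
    let ?U = "{y \<in> carrier G. inv x \<otimes> y \<in> K 0}" and ?C = "(\<lambda>\<kappa>. x \<otimes> \<kappa> \<otimes> \<one>) ` K 0"
    have "compactin coset_topology ?C"
      using x by (intro image_compactin[OF K0] continuous_map_translation[OF topological_group_coset_topology]) auto
    moreover have "?U \<subseteq> ?C"
    proof
      fix y assume y: "y \<in> ?U"
      then have "y = x \<otimes> (inv x \<otimes> y) \<otimes> \<one>" using x by (simp add: m_assoc[symmetric])
      then show "y \<in> ?C" using y by blast
    qed
    moreover have "x \<in> ?U" using x subgroup.one_closed[OF K_subgroup] by simp
    ultimately show "\<exists>U C. openin coset_topology U \<and> compactin coset_topology C \<and> x \<in> U \<and> U \<subseteq> C"
      using openin_coset[OF x, of 0] by blast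
  qed
qed

end

section \<open>Permutations that are flips almost everywhere\<close>

type_synonym pairing_perm = "nat \<times> bool \<Rightarrow> nat \<times> bool"

definition flip :: "(nat \<Rightarrow> bool) \<Rightarrow> pairing_perm" where
  "flip \<epsilon> = (\<lambda>(n, b). (n, b \<noteq> \<epsilon> n))"

definition almost_flips :: "pairing_perm set" where
  "almost_flips = {\<sigma>. bij \<sigma> \<and> (\<exists>\<epsilon>. finite {p. \<sigma> p \<noteq> flip \<epsilon> p})}"

definition late_flips :: "nat \<Rightarrow> pairing_perm set" where
  "late_flips n = {flip \<epsilon> | \<epsilon>. \<forall>i<n. \<not> \<epsilon> i}"

lemma flip_flip: "flip \<epsilon> (flip \<delta> p) = flip (\<lambda>n. \<epsilon> n \<noteq> \<delta> n) p"
  by (cases p) (auto simp: flip_def)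

lemma flip_comp: "flip \<epsilon> \<circ> flip \<delta> = flip (\<lambda>n. \<epsilon> n \<noteq> \<delta> n)"
  by (simp add: fun_eq_iff flip_flip)

lemma flip_False: "flip (\<lambda>_. False) = id"
  by (auto simp: flip_def)

lemma flip_involution [simp]: "flip \<epsilon> (flip \<epsilon> p) = p"
  by (cases p) (auto simp: flip_def)

lemma flip_commute: "flip \<epsilon> (flip \<delta> p) = flip \<delta> (flip \<epsilon> p)"
  by (cases p) (auto simp: flip_def)

lemma bij_flip: "bij (flip \<epsilon>)"
  by (rule involuntory_imp_bij) simp

lemma inv_flip: "inv_into UNIV (flip \<epsilon>) = flip \<epsilon>"
  by (rule inv_unique_comp) (auto simp: fun_eq_iff)

lemma fst_flip [simp]: "fst (flip \<epsilon> p) = fst p"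
  by (cases p) (auto simp: flip_def)

lemma flip_id_at: "\<not> \<epsilon> (fst p) \<Longrightarrow> flip \<epsilon> p = p"
  by (cases p) (auto simp: flip_def)

lemma flip_in_almost_flips: "flip \<epsilon> \<in> almost_flips"
  by (auto simp: almost_flips_def bij_flip intro!: exI[of _ \<epsilon>])

lemma late_flips_subset: "late_flips n \<subseteq> almost_flips"
  by (auto simp: late_flips_def flip_in_almost_flips)

lemma finite_support_in_almost_flips:
  assumes "bij \<sigma>" "finite {p. \<sigma> p \<noteq> p}"
  shows "\<sigma> \<in> almost_flips"
  using assms flip_False by (auto simp: almost_flips_def intro!: exI[of _ "\<lambda>_. False"])

lemma transpose_in_almost_flips: "Transposition.transpose p q \<in> almost_flips"
proof (rule finite_support_in_almost_flips)
  have "{r. Transposition.transpose p q r \<noteq> r} \<subseteq> {p, q}" by (auto simp: Transposition.transpose_def)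
  then show "finite {r. Transposition.transpose p q r \<noteq> r}" by (rule finite_subset) simp
qed simp

lemma comp_in_almost_flips:
  assumes "\<sigma> \<in> almost_flips" "\<tau> \<in> almost_flips"
  shows "\<sigma> \<circ> \<tau> \<in> almost_flips"
proof -
  obtain \<epsilon> \<delta> where e: "bij \<sigma>" "finite {p. \<sigma> p \<noteq> flip \<epsilon> p}" and d: "bij \<tau>" "finite {p. \<tau> p \<noteq> flip \<delta> p}"
    using assms by (auto simp: almost_flips_def)
  have "{p. (\<sigma> \<circ> \<tau>) p \<noteq> flip (\<lambda>n. \<epsilon> n \<noteq> \<delta> n) p} \<subseteq>
      {p. \<tau> p \<noteq> flip \<delta> p} \<union> flip \<delta> -` {p. \<sigma> p \<noteq> flip \<epsilon> p}"
  proof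
    fix p assume "p \<in> {p. (\<sigma> \<circ> \<tau>) p \<noteq> flip (\<lambda>n. \<epsilon> n \<noteq> \<delta> n) p}"
    then have "\<sigma> (\<tau> p) \<noteq> flip \<epsilon> (flip \<delta> p)" by (simp add: flip_flip)
    then show "p \<in> {p. \<tau> p \<noteq> flip \<delta> p} \<union> flip \<delta> -` {p. \<sigma> p \<noteq> flip \<epsilon> p}"
      by (cases "\<tau> p = flip \<delta> p") simp_all
  qed
  moreover have "finite (flip \<delta> -` {p. \<sigma> p \<noteq> flip \<epsilon> p})"
    by (rule finite_vimageI[OF e(2)]) (rule bij_is_inj[OF bij_flip])
  ultimately have "finite {p. (\<sigma> \<circ> \<tau>) p \<noteq> flip (\<lambda>n. \<epsilon> n \<noteq> \<delta> n) p}"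
    using d(2) by (meson finite_Un finite_subset)
  then show ?thesis using bij_comp[OF d(1) e(1)] by (auto simp: almost_flips_def)
qed

lemma inv_in_almost_flips:
  assumes "\<sigma> \<in> almost_flips"
  shows "inv_into UNIV \<sigma> \<in> almost_flips"
proof -
  obtain \<epsilon> where e: "bij \<sigma>" "finite {p. \<sigma> p \<noteq> flip \<epsilon> p}"
    using assms by (auto simp: almost_flips_def)
  have "{q. inv_into UNIV \<sigma> q \<noteq> flip \<epsilon> q} \<subseteq> \<sigma> ` {p. \<sigma> p \<noteq> flip \<epsilon> p}"
  proof
    fix q assume q: "q \<in> {q. inv_into UNIV \<sigma> q \<noteq> flip \<epsilon> q}"
    have s: "\<sigma> (inv_into UNIV \<sigma> q) = q" using e(1) by (simp add: bij_is_surj surj_f_inv_f)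
    have "\<sigma> (inv_into UNIV \<sigma> q) \<noteq> flip \<epsilon> (inv_into UNIV \<sigma> q)" 
    proof
      assume "\<sigma> (inv_into UNIV \<sigma> q) = flip \<epsilon> (inv_into UNIV \<sigma> q)"
      then have "q = flip \<epsilon> (inv_into UNIV \<sigma> q)" unfolding s .
      then have "flip \<epsilon> q = flip \<epsilon> (flip \<epsilon> (inv_into UNIV \<sigma> q))" by (rule arg_cong)
      then show False using q by simp
    qed
    then show "q \<in> \<sigma> ` {p. \<sigma> p \<noteq> flip \<epsilon> p}" by (subst s[symmetric]) (intro imageI CollectI)
  qed
  then have "finite {q. inv_into UNIV \<sigma> q \<noteq> flip \<epsilon> q}" using e(2) by (meson finite_imageI finite_subset)
  then show ?thesis using bij_imp_bij_inv[OF e(1)] by (auto simp: almost_flips_def)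
qed

text \<open>
  Beyond the finite set where \<open>\<sigma>\<close> differs from some flip, it preserves the blocks and acts on them
  as that flip; being injective, it cannot map an earlier block there. Flips commute with each other.
\<close>

lemma late_flips_eventually_central:
  assumes "\<sigma> \<in> almost_flips"
  shows "\<exists>n. \<forall>\<kappa>\<in>late_flips n. \<sigma> \<circ> \<kappa> = \<kappa> \<circ> \<sigma>"
proof -
  obtain \<epsilon> where s: "bij \<sigma>" "finite {p. \<sigma> p \<noteq> flip \<epsilon> p}"
    using assms by (auto simp: almost_flips_def)
  define n where "n = Suc (Max (insert 0 (fst ` {p. \<sigma> p \<noteq> flip \<epsilon> p})))"
  have late: "\<sigma> p = flip \<epsilon> p" if "fst p \<ge> n" for p
  proof (rule ccontr)
    assume "\<sigma> p \<noteq> flip \<epsilon> p"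
    then have "fst p \<le> Max (insert 0 (fst ` {p. \<sigma> p \<noteq> flip \<epsilon> p}))"
      using s(2) by (intro Max_ge) auto
    then show False using that by (simp add: n_def)
  qed
  have early: "fst (\<sigma> p) < n" if "fst p < n" for p
  proof (rule ccontr)
    assume "\<not> fst (\<sigma> p) < n"
    then have "\<sigma> (flip \<epsilon> (\<sigma> p)) = \<sigma> p" using late[of "flip \<epsilon> (\<sigma> p)"] by simp
    then have "flip \<epsilon> (\<sigma> p) = p" using s(1) by (simp add: bij_is_inj inj_eq)
    then have "fst (\<sigma> p) = fst p" using fst_flip[of \<epsilon> "\<sigma> p"] by simp
    then show False using \<open>\<not> fst (\<sigma> p) < n\<close> that by simp
  qed
  show ?thesis
  proof (intro exI[of _ n] ballI ext)
    fix \<kappa> p assume "\<kappa> \<in> late_flips n"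
    then obtain \<delta> where d: "\<kappa> = flip \<delta>" "\<And>i. i < n \<Longrightarrow> \<not> \<delta> i" by (auto simp: late_flips_def)
    show "(\<sigma> \<circ> \<kappa>) p = (\<kappa> \<circ> \<sigma>) p"
    proof (cases "fst p < n")
      case True
      then show ?thesis using d(2) early[OF True] by (simp add: d(1) flip_id_at)
    next
      case False
      then show ?thesis using late[of p] late[of "flip \<delta> p"] by (simp add: d(1) flip_commute)
    qed
  qed
qed

section \<open>The topological group of almost flips\<close>

text \<open>
  The injection \<open>e\<close> transports the permutation group to any type that is large enough.
\<close>

locale encoded_almost_flips =
  fixes e :: "pairing_perm \<Rightarrow> 'a"
  assumes inj_e: "inj e"
begin

definition G :: "'a monoid" where
  "G = \<lparr>carrier = e ` almost_flips,
        mult = (\<lambda>x y. e (the_inv e x \<circ> the_inv e y)), one = e id\<rparr>"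

lemma e_eq_iff [simp]: "e \<sigma> = e \<tau> \<longleftrightarrow> \<sigma> = \<tau>"
  using inj_e by (simp add: inj_eq)

lemma carrier_G: "carrier G = e ` almost_flips" by (simp add: G_def)

lemma e_in_carrier [simp]: "e \<sigma> \<in> carrier G \<longleftrightarrow> \<sigma> \<in> almost_flips"
  by (auto simp: carrier_G)

lemma mult_G [simp]: "e \<sigma> \<otimes>\<^bsub>G\<^esub> e \<tau> = e (\<sigma> \<circ> \<tau>)"
  by (simp add: G_def the_inv_f_f[OF inj_e])

lemma one_G: "\<one>\<^bsub>G\<^esub> = e id" by (simp add: G_def)

lemma id_in_almost_flips: "id \<in> almost_flips"
  using flip_in_almost_flips[of "\<lambda>_. False"] by (simp add: flip_False)

lemma bij_almost_flips: "\<sigma> \<in> almost_flips \<Longrightarrow> bij \<sigma>" by (simp add: almost_flips_def)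

lemma inv_comp_almost_flips: "\<sigma> \<in> almost_flips \<Longrightarrow> inv_into UNIV \<sigma> \<circ> \<sigma> = id"
  by (simp add: bij_almost_flips bij_is_inj)

sublocale group G
proof (rule groupI)
  fix x assume "x \<in> carrier G"
  then obtain \<sigma> where s: "x = e \<sigma>" "\<sigma> \<in> almost_flips" by (auto simp: carrier_G)
  then have "e (inv_into UNIV \<sigma>) \<otimes>\<^bsub>G\<^esub> x = \<one>\<^bsub>G\<^esub>" by (simp add: one_G inv_comp_almost_flips)
  then show "\<exists>y\<in>carrier G. y \<otimes>\<^bsub>G\<^esub> x = \<one>\<^bsub>G\<^esub>"
    using inv_in_almost_flips[OF s(2)] by (intro bexI[of _ "e (inv_into UNIV \<sigma>)"]) auto
qed (auto simp: carrier_G one_G id_in_almost_flips comp_in_almost_flips comp_assoc)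

lemma inv_G [simp]: "\<sigma> \<in> almost_flips \<Longrightarrow> inv\<^bsub>G\<^esub> (e \<sigma>) = e (inv_into UNIV \<sigma>)"
  by (rule inv_equality) (auto simp: one_G inv_comp_almost_flips inv_in_almost_flips)

sublocale filtered_group G "\<lambda>n. e ` late_flips n"
proof (intro filtered_group.intro filtered_group_axioms.intro is_group)
  fix n
  show "subgroup (e ` late_flips n) G"
  proof (rule subgroupI)
    show "e ` late_flips n \<subseteq> carrier G" using late_flips_subset by (auto simp: carrier_G)
    show "e ` late_flips n \<noteq> {}" by (auto simp: late_flips_def)
  next
    fix x assume "x \<in> e ` late_flips n"
    then obtain \<epsilon> where "x = e (flip \<epsilon>)" "\<forall>i<n. \<not> \<epsilon> i" by (auto simp: late_flips_def)
    then show "inv\<^bsub>G\<^esub> x \<in> e ` late_flips n"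
      by (auto simp: flip_in_almost_flips inv_flip late_flips_def)
  next
    fix x y assume "x \<in> e ` late_flips n" "y \<in> e ` late_flips n"
    then obtain \<epsilon> \<delta> where "x = e (flip \<epsilon>)" "\<forall>i<n. \<not> \<epsilon> i" "y = e (flip \<delta>)" "\<forall>i<n. \<not> \<delta> i"
      by (auto simp: late_flips_def)
    then show "x \<otimes>\<^bsub>G\<^esub> y \<in> e ` late_flips n"
      by (auto simp: flip_comp late_flips_def)
  qed
next
  fix m n :: nat assume "m \<le> n"
  then show "e ` late_flips n \<subseteq> e ` late_flips m"
    by (intro image_mono) (auto simp: late_flips_def)
next
  fix x assume "x \<in> carrier G" and x: "\<And>n. x \<in> e ` late_flips n"
  then obtain \<sigma> where s: "x = e \<sigma>" by (auto simp: carrier_G)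
  have "\<sigma> p = p" for p
  proof -
    have "\<sigma> \<in> late_flips (Suc (fst p))" using x[of "Suc (fst p)"] s by auto
    then show ?thesis by (auto simp: late_flips_def flip_id_at)
  qed
  then show "x = \<one>\<^bsub>G\<^esub>" by (auto simp: s one_G)
next
  fix x assume "x \<in> carrier G"
  then obtain \<sigma> where s: "x = e \<sigma>" "\<sigma> \<in> almost_flips" by (auto simp: carrier_G)
  show "\<exists>n. \<forall>\<kappa>\<in>e ` late_flips n. x \<otimes>\<^bsub>G\<^esub> \<kappa> = \<kappa> \<otimes>\<^bsub>G\<^esub> x"
    using late_flips_eventually_central[OF s(2)] by (auto simp: s(1))
qed

abbreviation T where "T \<equiv> coset_topology"

text \<open>
  The flips are a continuous image of the Cantor space.
\<close>

lemma compactin_all_flips: "compactin T (e ` late_flips 0)"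
proof -
  define P where "P = product_topology (\<lambda>_::nat. discrete_topology (UNIV :: bool set)) UNIV"
  have topP: "topspace P = UNIV" by (simp add: P_def PiE_UNIV_domain)
  have "compact_space P"
    unfolding P_def by (simp add: compact_space_product_topology compact_space_discrete_topology)
  then have "compactin P UNIV" by (simp add: compact_space_def topP)
  moreover have "continuous_map P T (\<lambda>\<epsilon>. e (flip \<epsilon>))"
    unfolding continuous_map_def
  proof (intro conjI allI impI)
    show "(\<lambda>\<epsilon>. e (flip \<epsilon>)) \<in> topspace P \<rightarrow> topspace T" by (simp add: flip_in_almost_flips)
    fix U assume U: "openin T U"
    show "openin P {\<epsilon> \<in> topspace P. e (flip \<epsilon>) \<in> U}"
    proof (subst openin_subopen, intro ballI)
      fix \<epsilon> assume "\<epsilon> \<in> {\<epsilon> \<in> topspace P. e (flip \<epsilon>) \<in> U}"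
      then obtain n where n: "\<forall>\<kappa>\<in>e ` late_flips n. e (flip \<epsilon>) \<otimes>\<^bsub>G\<^esub> \<kappa> \<in> U"
        using U unfolding openin_coset_topology by blast
      let ?W = "PiE UNIV (\<lambda>i. if i < n then {\<epsilon> i} else UNIV)"
      have "openin P ?W"
        unfolding P_def openin_PiE_gen by (auto intro: finite_subset[of _ "{..<n}"])
      moreover have "\<epsilon> \<in> ?W" by auto
      moreover have "e (flip \<delta>) \<in> U" if "\<delta> \<in> ?W" for \<delta>
      proof -
        have "\<delta> i = \<epsilon> i" if "i < n" for i
          using PiE_mem[OF \<open>\<delta> \<in> ?W\<close>, of i] that by simp
        then have "e (flip (\<lambda>i. \<epsilon> i \<noteq> \<delta> i)) \<in> e ` late_flips n" by (auto simp: late_flips_def)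
        with n have "e (flip \<epsilon>) \<otimes>\<^bsub>G\<^esub> e (flip (\<lambda>i. \<epsilon> i \<noteq> \<delta> i)) \<in> U" by blast
        moreover have "(\<lambda>i. \<epsilon> i \<noteq> (\<epsilon> i \<noteq> \<delta> i)) = \<delta>" by auto
        ultimately show ?thesis by (simp add: flip_comp)
      qed
      ultimately show "\<exists>W. openin P W \<and> \<epsilon> \<in> W \<and> W \<subseteq> {\<epsilon> \<in> topspace P. e (flip \<epsilon>) \<in> U}"
        unfolding topP by blast
    qed
  qed
  ultimately have "compactin T ((\<lambda>\<epsilon>. e (flip \<epsilon>)) ` UNIV)" by (rule image_compactin)
  moreover have "(\<lambda>\<epsilon>. e (flip \<epsilon>)) ` UNIV = e ` late_flips 0" by (auto simp: late_flips_def)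
  ultimately show ?thesis by simp
qed

text \<open>
  On flips the topology is that of pointwise convergence of the sets of flipped blocks.
\<close>

lemma limitin_flip:
  assumes "\<And>i. \<forall>\<^sub>F m in sequentially. \<delta> m i = \<epsilon> i"
  shows "limitin T (\<lambda>m. e (flip (\<delta> m))) (e (flip \<epsilon>)) sequentially"
proof (rule limitin_coset_topology)
  show "e (flip \<epsilon>) \<in> carrier G" by (simp add: flip_in_almost_flips)
  fix n
  have "\<forall>\<^sub>F m in sequentially. \<forall>i\<in>{..<n}. \<delta> m i = \<epsilon> i"
    by (rule eventually_ball_finite) (use assms in auto)
  then show "\<forall>\<^sub>F m in sequentially. e (flip (\<delta> m)) \<in> carrier G \<and>
      inv\<^bsub>G\<^esub> e (flip \<epsilon>) \<otimes>\<^bsub>G\<^esub> e (flip (\<delta> m)) \<in> e ` late_flips n"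
    by eventually_elim (auto simp: flip_in_almost_flips inv_flip flip_comp late_flips_def)
qed

section \<open>Functions with weakly compact double orbit are constant\<close>

text \<open>
  A finitary involution of the blocks that exchanges the first \<open>m\<close> blocks with the \<open>m\<close> blocks
  from \<open>2 ^ m\<close> on. For \<open>m > 0\<close> the only power of two among the latter is \<open>2 ^ m\<close> itself; this
  is why the powers of two serve below as the sparse set of flipped blocks.
\<close>

definition block_swap :: "nat \<Rightarrow> nat \<Rightarrow> nat" where
  "block_swap m i = (if i < m then i + 2 ^ m else if 2 ^ m \<le> i \<and> i < 2 ^ m + m then i - 2 ^ m else i)"

definition level_swap :: "nat \<Rightarrow> pairing_perm" where
  "level_swap m = map_prod (block_swap m) id"

lemma block_swap_involution [simp]: "block_swap m (block_swap m i) = i"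
proof -
  have "\<not> k + 2 ^ m < m" for k using less_exp[of m] by linarith
  then show ?thesis by (auto simp: block_swap_def)
qed

lemma level_swap_involution [simp]: "level_swap m (level_swap m p) = p"
  by (cases p) (simp add: level_swap_def)

lemma level_swap_in_almost_flips: "level_swap m \<in> almost_flips"
proof (rule finite_support_in_almost_flips)
  show "bij (level_swap m)" by (rule involuntory_imp_bij) simp
  have "{p. level_swap m p \<noteq> p} \<subseteq> {..<2 ^ m + m} \<times> UNIV"
    by (auto simp: level_swap_def block_swap_def split: if_splits)
  then show "finite {p. level_swap m p \<noteq> p}" by (rule finite_subset) simp
qed

lemma level_swap_conj: "level_swap m \<circ> flip \<epsilon> \<circ> level_swap m = flip (\<epsilon> \<circ> block_swap m)"
  by (auto simp: fun_eq_iff level_swap_def flip_def)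

lemma power_of_two_near_power_of_two:
  assumes "i < m" "(i::nat) + 2 ^ m = 2 ^ j"
  shows "i = 0"
proof (rule ccontr)
  assume "i \<noteq> 0"
  then have "(2::nat) ^ m < 2 ^ j" using assms(2) by linarith
  then have "Suc m \<le> j" by (simp add: Suc_leI)
  then have "(2::nat) ^ Suc m \<le> 2 ^ j" by (rule power_increasing) simp
  then show False using assms less_exp[of m] unfolding power_Suc by linarith
qed

text \<open>
  Conjugation by \<open>level_swap m\<close> turns the flip of all powers of two into a flip that, for large
  \<open>m\<close>, involves block 0 and no other early block. A flip of finitely many blocks is turned into a
  flip of late blocks only, for large \<open>m\<close>, and so tends to the unit.
\<close>

lemma WS_ignores_block_0_flip:
  assumes f: "f \<in> WS G T" and a: "a \<in> carrier G" and b: "b \<in> carrier G"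
  shows "f (a \<otimes>\<^bsub>G\<^esub> e (flip (\<lambda>i. i = 0)) \<otimes>\<^bsub>G\<^esub> b) = f (a \<otimes>\<^bsub>G\<^esub> b)"
proof -
  note G = topological_group_coset_topology
  define \<epsilon> where "\<epsilon> i \<longleftrightarrow> i \<in> range (\<lambda>j. 2 ^ j)" for i :: nat
  define s where "s m = e (level_swap m)" for m
  define k where "k n = e (flip (\<lambda>i. \<epsilon> i \<and> i < n))" for n
  have s: "s m \<in> carrier G" for m by (simp add: s_def level_swap_in_almost_flips)
  have conj: "a \<otimes>\<^bsub>G\<^esub> s m \<otimes>\<^bsub>G\<^esub> e (flip \<delta>) \<otimes>\<^bsub>G\<^esub> (s m \<otimes>\<^bsub>G\<^esub> b)
      = a \<otimes>\<^bsub>G\<^esub> e (flip (\<delta> \<circ> block_swap m)) \<otimes>\<^bsub>G\<^esub> b" for \<delta> m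
  proof -
    have "a \<otimes>\<^bsub>G\<^esub> s m \<otimes>\<^bsub>G\<^esub> e (flip \<delta>) \<otimes>\<^bsub>G\<^esub> (s m \<otimes>\<^bsub>G\<^esub> b)
      = a \<otimes>\<^bsub>G\<^esub> (s m \<otimes>\<^bsub>G\<^esub> e (flip \<delta>) \<otimes>\<^bsub>G\<^esub> s m) \<otimes>\<^bsub>G\<^esub> b"
      using a b s flip_in_almost_flips by (simp add: m_assoc del: mult_G)
    also have "s m \<otimes>\<^bsub>G\<^esub> e (flip \<delta>) \<otimes>\<^bsub>G\<^esub> s m = e (flip (\<delta> \<circ> block_swap m))"
      by (simp add: s_def level_swap_conj)
    finally show ?thesis .
  qed
  have bs: "\<forall>\<^sub>F m in sequentially. block_swap m i = i + 2 ^ m" for i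
    using eventually_gt_at_top[of i] by eventually_elim (simp add: block_swap_def)
  have "f (a \<otimes>\<^bsub>G\<^esub> e (flip (\<lambda>i. False)) \<otimes>\<^bsub>G\<^esub> b) = f (a \<otimes>\<^bsub>G\<^esub> e (flip (\<lambda>i. i = 0)) \<otimes>\<^bsub>G\<^esub> b)"
  proof (rule WS_double_limit[OF G f, where x = "\<lambda>m. a \<otimes>\<^bsub>G\<^esub> s m" and y = "\<lambda>m. s m \<otimes>\<^bsub>G\<^esub> b" and k = k
        and k' = "e (flip \<epsilon>)"])
    show "limitin T k (e (flip \<epsilon>)) sequentially"
      unfolding k_def
    proof (rule limitin_flip)
      fix i show "\<forall>\<^sub>F n in sequentially. (\<epsilon> i \<and> i < n) = \<epsilon> i"
        using eventually_gt_at_top[of i] by eventually_elim simp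
    qed
    show "limitin T (\<lambda>m. a \<otimes>\<^bsub>G\<^esub> s m \<otimes>\<^bsub>G\<^esub> k n \<otimes>\<^bsub>G\<^esub> (s m \<otimes>\<^bsub>G\<^esub> b))
        (a \<otimes>\<^bsub>G\<^esub> e (flip (\<lambda>i. False)) \<otimes>\<^bsub>G\<^esub> b) sequentially" for n
      unfolding k_def conj
    proof (intro limitin_translation[OF G a b] limitin_flip)
      fix i
      show "\<forall>\<^sub>F m in sequentially. ((\<lambda>i. \<epsilon> i \<and> i < n) \<circ> block_swap m) i = False"
        using bs[of i] eventually_ge_at_top[of n]
      proof eventually_elim
        case (elim m)
        moreover have "\<not> i + 2 ^ m < n" using elim(2) less_exp[of m] by linarith
        ultimately show ?case by simp
      qed
    qed
    show "limitin T (\<lambda>m. a \<otimes>\<^bsub>G\<^esub> s m \<otimes>\<^bsub>G\<^esub> e (flip \<epsilon>) \<otimes>\<^bsub>G\<^esub> (s m \<otimes>\<^bsub>G\<^esub> b))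
        (a \<otimes>\<^bsub>G\<^esub> e (flip (\<lambda>i. i = 0)) \<otimes>\<^bsub>G\<^esub> b) sequentially"
      unfolding conj
    proof (intro limitin_translation[OF G a b] limitin_flip)
      fix i :: nat
      show "\<forall>\<^sub>F m in sequentially. (\<epsilon> \<circ> block_swap m) i = (i = 0)"
        using bs[of i] eventually_gt_at_top[of i]
      proof eventually_elim
        case (elim m)
        then show ?case using power_of_two_near_power_of_two[of i m] by (auto simp: \<epsilon>_def)
      qed
    qed
  qed (use a b s flip_in_almost_flips in \<open>simp_all add: k_def\<close>)
  moreover have "e (flip (\<lambda>i. False)) = \<one>\<^bsub>G\<^esub>" by (simp add: flip_False one_G)
  ultimately show ?thesis using a b by simp
qed

lemma flip_0_eq_transpose: "flip (\<lambda>i. i = 0) = Transposition.transpose (0, False) (0, True)"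
  by (auto simp: fun_eq_iff flip_def Transposition.transpose_def)

text \<open>
  All transpositions are conjugate to the flip of block 0, and the factors \<open>a\<close> and \<open>b\<close> above
  absorb the conjugating elements.
\<close>

lemma WS_ignores_transpositions:
  assumes f: "f \<in> WS G T" and "p \<noteq> q" and \<tau>: "\<tau> \<in> almost_flips"
  shows "f (e (Transposition.transpose p q \<circ> \<tau>)) = f (e \<tau>)"
proof -
  define \<alpha> where "\<alpha> = Transposition.transpose (0, False) p"
  define \<pi> where "\<pi> = Transposition.transpose (\<alpha> (0, True)) q \<circ> \<alpha>"
  have \<pi>: "\<pi> \<in> almost_flips"
    unfolding \<pi>_def \<alpha>_def by (intro comp_in_almost_flips transpose_in_almost_flips)
  note inv\<pi> = inv_in_almost_flips[OF \<pi>]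
  have b: "bij \<pi>" by (rule bij_almost_flips[OF \<pi>])
  have "\<alpha> (0, False) = p" by (simp add: \<alpha>_def)
  moreover have "\<alpha> (0, True) \<noteq> \<alpha> (0, False)"
    unfolding \<alpha>_def by (subst inj_eq[OF bij_is_inj[OF bij_transpose]]) simp
  ultimately have \<pi>p: "\<pi> (0, False) = p" and \<pi>q: "\<pi> (0, True) = q"
    using \<open>p \<noteq> q\<close> by (auto simp: \<pi>_def Transposition.transpose_def)
  have "inv_into UNIV \<pi> p = (0, False)" "inv_into UNIV \<pi> q = (0, True)"
    using \<pi>p \<pi>q b by (auto simp: bij_is_inj inv_f_eq)
  then have "Transposition.transpose p q \<circ> \<pi> = \<pi> \<circ> flip (\<lambda>i. i = 0)"
    using transpose_comp_eq[OF b, of p q] by (simp add: flip_0_eq_transpose)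
  moreover have "\<pi> \<circ> inv_into UNIV \<pi> = id" using surj_iff[THEN iffD1, OF bij_is_surj[OF b]] .
  ultimately have "Transposition.transpose p q \<circ> \<tau> = \<pi> \<circ> flip (\<lambda>i. i = 0) \<circ> (inv_into UNIV \<pi> \<circ> \<tau>)"
    by (metis comp_assoc comp_id id_comp)
  then have "f (e (Transposition.transpose p q \<circ> \<tau>)) =
      f (e \<pi> \<otimes>\<^bsub>G\<^esub> e (flip (\<lambda>i. i = 0)) \<otimes>\<^bsub>G\<^esub> e (inv_into UNIV \<pi> \<circ> \<tau>))" by simp
  also have "\<dots> = f (e \<pi> \<otimes>\<^bsub>G\<^esub> e (inv_into UNIV \<pi> \<circ> \<tau>))"
    by (rule WS_ignores_block_0_flip[OF f]) (use \<pi> inv\<pi> \<tau> comp_in_almost_flips in simp_all)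
  also have "e \<pi> \<otimes>\<^bsub>G\<^esub> e (inv_into UNIV \<pi> \<circ> \<tau>) = e \<tau>"
    using \<open>\<pi> \<circ> inv_into UNIV \<pi> = id\<close> by (simp add: comp_assoc[symmetric])
  finally show ?thesis .
qed

lemma WS_constant_on_finitary:
  assumes f: "f \<in> WS G T" and "bij \<rho>" "finite {p. \<rho> p \<noteq> p}"
  shows "f (e \<rho>) = f (e id)"
proof -
  have "\<rho> permutes {p. \<rho> p \<noteq> p}"
    using assms(2) by (auto simp: permutes_def bij_iff)
  then show ?thesis using assms(3)
  proof (induction rule: permutes_induct)
    case id
    show ?case ..
  next
    case (swap p q \<rho>')
    have "finite {r. \<rho>' r \<noteq> r}"
      by (rule finite_subset[OF _ assms(3)])
        (use \<open>\<rho>' permutes _\<close> in \<open>auto simp: permutes_def\<close>)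
    then have \<rho>': "\<rho>' \<in> almost_flips"
      using permutes_bij[OF \<open>\<rho>' permutes _\<close>] by (rule finite_support_in_almost_flips[rotated])
    show ?case
      by (rule trans[OF WS_ignores_transpositions[OF f \<open>p \<noteq> q\<close> \<rho>'] \<open>f (e \<rho>') = f (e id)\<close>])
  qed
qed

text \<open>
  An element of the group is a finitary permutation times a flip; truncating the flip yields
  finitary permutations that converge to it.
\<close>

lemma WS_constant:
  assumes f: "f \<in> WS G T" and x: "x \<in> carrier G"
  shows "f x = f (e id)"
proof -
  note G = topological_group_coset_topology
  obtain \<sigma> \<epsilon> where s: "x = e \<sigma>" "bij \<sigma>" "finite {p. \<sigma> p \<noteq> flip \<epsilon> p}"
    using x by (auto simp: carrier_G almost_flips_def)
  define \<rho> where "\<rho> = \<sigma> \<circ> flip \<epsilon>"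
  define k where "k n = (\<lambda>i. \<epsilon> i \<and> i < n)" for n :: nat
  have \<sigma>: "\<sigma> = \<rho> \<circ> flip \<epsilon>" by (simp add: \<rho>_def fun_eq_iff)
  have "{p. \<rho> p \<noteq> p} \<subseteq> flip \<epsilon> -` {p. \<sigma> p \<noteq> flip \<epsilon> p}" by (auto simp: \<rho>_def)
  moreover have "finite (flip \<epsilon> -` {p. \<sigma> p \<noteq> flip \<epsilon> p})"
    by (rule finite_vimageI[OF s(3)]) (rule bij_is_inj[OF bij_flip])
  ultimately have \<rho>: "finite {p. \<rho> p \<noteq> p}" by (rule finite_subset)
  have b\<rho>: "bij \<rho>" unfolding \<rho>_def by (rule bij_comp[OF bij_flip s(2)])
  have \<rho>G: "e \<rho> \<in> carrier G" using finite_support_in_almost_flips[OF b\<rho> \<rho>] by simp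
  have "f (e (\<rho> \<circ> flip (k n))) = f (e id)" for n
  proof (rule WS_constant_on_finitary[OF f])
    show "bij (\<rho> \<circ> flip (k n))" by (rule bij_comp[OF bij_flip b\<rho>])
    have "{p. (\<rho> \<circ> flip (k n)) p \<noteq> p} \<subseteq> {p. \<rho> p \<noteq> p} \<union> {..<n} \<times> UNIV"
    proof
      fix p assume p: "p \<in> {p. (\<rho> \<circ> flip (k n)) p \<noteq> p}"
      show "p \<in> {p. \<rho> p \<noteq> p} \<union> {..<n} \<times> UNIV"
      proof (cases "fst p < n")
        case True
        then show ?thesis by (cases p) simp
      next
        case False
        then have "flip (k n) p = p" by (simp add: flip_id_at k_def)
        then show ?thesis using p by simp
      qed
    qed
    then show "finite {p. (\<rho> \<circ> flip (k n)) p \<noteq> p}" by (rule finite_subset) (use \<rho> in simp)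
  qed
  moreover have "limitin T (\<lambda>n. e (flip (k n))) (e (flip \<epsilon>)) sequentially"
  proof (rule limitin_flip)
    fix i show "\<forall>\<^sub>F n in sequentially. k n i = \<epsilon> i"
      unfolding k_def using eventually_gt_at_top[of i] by eventually_elim simp
  qed
  from limitin_translation[OF G \<rho>G one_closed this]
  have "limitin T (\<lambda>n. e (\<rho> \<circ> flip (k n))) x sequentially"
    by (simp add: one_G s(1) \<sigma>)
  from continuous_map_limit[OF _ this, of euclidean f]
  have "(\<lambda>n. f (e (\<rho> \<circ> flip (k n)))) \<longlonglongrightarrow> f x"
    using f by (simp add: WS_def Cb_iff o_def)
  ultimately show ?thesis by (simp add: LIMSEQ_const_iff)
qed

lemma WS_eq_AP: "WS G T = AP G T"
proof
  show "AP G T \<subseteq> WS G T" by (rule AP_subset_WS[OF topological_group_coset_topology])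
  show "WS G T \<subseteq> AP G T"
  proof
    fix f assume f: "f \<in> WS G T"
    then have "f \<in> extensional (carrier G)" by (simp add: WS_def Cb_iff)
    then have "f = (\<lambda>x\<in>carrier G. f (e id))"
      using WS_constant[OF f] by (auto simp: extensional_def)
    then show "f \<in> AP G T" using const_in_AP[OF topological_group_coset_topology] by metis
  qed
qed

section \<open>A noncompact open subgroup of infinite index\<close>

definition stabilizer :: "'a set" where
  "stabilizer = e ` {\<sigma> \<in> almost_flips. \<sigma> (0, False) = (0, False)}"

lemma subgroup_stabilizer: "subgroup stabilizer G"
proof (rule subgroupI)
  show "stabilizer \<subseteq> carrier G" by (auto simp: stabilizer_def carrier_G)
  show "stabilizer \<noteq> {}" using id_in_almost_flips by (auto simp: stabilizer_def)
  show "inv\<^bsub>G\<^esub> x \<in> stabilizer" if "x \<in> stabilizer" for x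
    using that inv_in_almost_flips
    by (auto simp: stabilizer_def bij_almost_flips bij_is_inj intro!: inv_f_eq)
  show "x \<otimes>\<^bsub>G\<^esub> y \<in> stabilizer" if "x \<in> stabilizer" "y \<in> stabilizer" for x y
    using that comp_in_almost_flips by (auto simp: stabilizer_def)
qed

lemma openin_stabilizer: "openin T stabilizer"
  unfolding openin_coset_topology
proof (intro conjI ballI)
  show "stabilizer \<subseteq> carrier G" by (auto simp: stabilizer_def carrier_G)
  fix x assume "x \<in> stabilizer"
  then obtain \<sigma> where \<sigma>: "x = e \<sigma>" "\<sigma> \<in> almost_flips" "\<sigma> (0, False) = (0, False)"
    by (auto simp: stabilizer_def)
  show "\<exists>n. \<forall>\<kappa>\<in>e ` late_flips n. x \<otimes>\<^bsub>G\<^esub> \<kappa> \<in> stabilizer"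
  proof (intro exI[of _ 1] ballI)
    fix \<kappa> assume "\<kappa> \<in> e ` late_flips 1"
    then obtain \<epsilon> where \<epsilon>: "\<kappa> = e (flip \<epsilon>)" "\<not> \<epsilon> 0" by (auto simp: late_flips_def)
    have "\<sigma> \<circ> flip \<epsilon> \<in> almost_flips" by (rule comp_in_almost_flips[OF \<sigma>(2) flip_in_almost_flips])
    moreover have "(\<sigma> \<circ> flip \<epsilon>) (0, False) = (0, False)" using \<epsilon>(2) \<sigma>(3) by (simp add: flip_id_at)
    ultimately show "x \<otimes>\<^bsub>G\<^esub> \<kappa> \<in> stabilizer" unfolding stabilizer_def \<sigma>(1) \<epsilon>(1) mult_G by blast
  qed
qed

text \<open>
  The elements of one coset of the group of flips send \<open>(1, False)\<close> to at most two points. But the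
  stabilizer of \<open>(0, False)\<close> sends it to infinitely many, so finitely many cosets do not cover it.
\<close>

lemma noncompact_stabilizer: "\<not> compactin T stabilizer"
proof
  assume c: "compactin T stabilizer"
  let ?V = "\<lambda>x. {y \<in> carrier G. inv\<^bsub>G\<^esub> x \<otimes>\<^bsub>G\<^esub> y \<in> e ` late_flips 0}"
  have sub: "stabilizer \<subseteq> carrier G" by (auto simp: stabilizer_def carrier_G)
  have "(\<forall>U\<in>?V ` stabilizer. openin T U) \<and> stabilizer \<subseteq> \<Union> (?V ` stabilizer)"
  proof
    show "\<forall>U\<in>?V ` stabilizer. openin T U" using openin_coset sub by blast
    have "x \<in> ?V x" if "x \<in> stabilizer" for x
      using that sub subgroup.one_closed[OF K_subgroup] by (auto simp del: mult_G)
    then show "stabilizer \<subseteq> \<Union> (?V ` stabilizer)" by blast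
  qed
  then obtain \<F> where F: "finite \<F>" "\<F> \<subseteq> ?V ` stabilizer" "stabilizer \<subseteq> \<Union>\<F>"
    using c unfolding compactin_def by meson
  obtain S where S: "finite S" "S \<subseteq> stabilizer" "\<F> = ?V ` S"
    using F(1,2) by (metis (no_types, lifting) finite_subset_image)
  let ?P = "\<Union>x\<in>S. {the_inv e x (1, False), the_inv e x (1, True)}"
  have "(i, False) \<in> ?P" if i: "i \<ge> 1" for i
  proof -
    let ?t = "Transposition.transpose (1, False) (i, False) :: pairing_perm"
    have "e ?t \<in> stabilizer"
      using i transpose_in_almost_flips by (auto simp: stabilizer_def Transposition.transpose_def)
    then obtain x where x: "x \<in> S" "e ?t \<in> ?V x" using F(3) S(3) by blast
    obtain \<tau> where \<tau>: "x = e \<tau>" "\<tau> \<in> almost_flips" using x(1) S(2) sub by (auto simp: carrier_G)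
    obtain \<epsilon> where "inv_into UNIV \<tau> \<circ> ?t = flip \<epsilon>" using x(2) \<tau> by (auto simp: late_flips_def)
    then have "?t = \<tau> \<circ> flip \<epsilon>"
      using bij_almost_flips[OF \<tau>(2)] by (metis bij_is_surj comp_assoc id_comp surj_iff)
    then have "(i, False) = \<tau> (flip \<epsilon> (1, False))" by (metis comp_apply transpose_apply_first)
    moreover have "flip \<epsilon> (1, False) \<in> {(1, False), (1, True)}" by (auto simp: flip_def)
    ultimately have "(i, False) \<in> {\<tau> (1, False), \<tau> (1, True)}" by auto
    then show ?thesis using x(1) by (auto simp: \<tau>(1) the_inv_f_f[OF inj_e] intro!: bexI[of _ "e \<tau>"])
  qed
  then have "(\<lambda>i. (i, False)) ` {1..} \<subseteq> ?P" by auto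
  moreover have "finite ?P" using S(1) by simp
  ultimately have "finite ((\<lambda>i. (i, False)) ` {1::nat..})" by (rule finite_subset)
  then have "finite {1::nat..}" by (rule finite_imageD) (simp add: inj_on_def)
  then show False using infinite_Ici by blast
qed

lemma noncompact: "\<not> compact_space T"
  using noncompact_stabilizer open_subgroup_closed[OF topological_group_coset_topology subgroup_stabilizer openin_stabilizer]
    closedin_compact_space by blast

lemma not_minimally_WAP: "\<not> minimally_weakly_almost_periodic G T"
proof (rule not_minimally_WAP_if_open_subgroup[OF topological_group_coset_topology
      subgroup_stabilizer openin_stabilizer noncompact_stabilizer])
  \<comment> \<open>these move \<open>(0, False)\<close> to different points, so they represent different cosets\<close>
  let ?t = "\<lambda>i::nat. Transposition.transpose (0, False) (i, False) :: pairing_perm"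
  have t0: "?t i (0, False) = (i, False)" for i by simp
  have "inj (\<lambda>i. e (?t i))"
    by (rule injI) (metis e_eq_iff t0 prod.inject)
  then show "infinite (range (\<lambda>i. e (?t i)))" by (rule range_inj_infinite)
  show "range (\<lambda>i. e (?t i)) \<subseteq> carrier G" using transpose_in_almost_flips by auto
  fix x y assume "x \<in> range (\<lambda>i. e (?t i))" "y \<in> range (\<lambda>i. e (?t i))" "x \<noteq> y"
  then obtain i j where ij: "x = e (?t i)" "y = e (?t j)" "i \<noteq> j" by blast
  have "(?t i \<circ> ?t j) (0, False) \<noteq> (0, False)"
    using ij(3) by (auto simp: Transposition.transpose_def)
  then show "x \<otimes>\<^bsub>G\<^esub> inv\<^bsub>G\<^esub> y \<notin> stabilizer"
    using transpose_in_almost_flips by (auto simp: ij stabilizer_def)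
qed

end

text \<open>
  A permutation is coded by its graph, a subset of a countable set.
\<close>

lemma inj_perm_to_real: "\<exists>e :: pairing_perm \<Rightarrow> real. inj e"
proof -
  obtain r :: "nat set \<Rightarrow> real" where r: "inj r"
    using nat_sets_lepoll_reals01 unfolding lepoll_def by blast
  have "inj (\<lambda>\<sigma> :: pairing_perm. r (range (\<lambda>p. to_nat (p, \<sigma> p))))"
  proof (rule injI)
    fix \<sigma> \<tau> :: pairing_perm
    assume "r (range (\<lambda>p. to_nat (p, \<sigma> p))) = r (range (\<lambda>p. to_nat (p, \<tau> p)))"
    then have eq: "range (\<lambda>p. to_nat (p, \<sigma> p)) = range (\<lambda>p. to_nat (p, \<tau> p))"
      using r by (simp add: inj_eq)
    show "\<sigma> = \<tau>"
    proof
      fix p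
      have "to_nat (p, \<sigma> p) \<in> range (\<lambda>p. to_nat (p, \<tau> p))" unfolding eq[symmetric] by blast
      then show "\<sigma> p = \<tau> p" by auto
    qed
  qed
  then show ?thesis by blast
qed

theorem mainTheorem3:
  shows "\<exists>(G :: label monoid) (T :: label topology).
           locally_compact_group G T \<and> \<not> compact_space T \<and>
           WS G T = AP G T \<and>
           \<not> minimally_weakly_almost_periodic G T"
proof -
  obtain e :: "pairing_perm \<Rightarrow> label" where "inj e" using inj_perm_to_real by blast
  then interpret encoded_almost_flips e by unfold_locales
  show ?thesis
    using locally_compact_group_coset_topology[OF compactin_all_flips] noncompact WS_eq_AP not_minimally_WAP
    by blast
qed

end
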